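(* Let $\gamma\in C^5([0,4h];\mathbb{S}^2)$, and assume that all data points and all intermediate points generated by the SIDER4 construction lie in a common geodesically convex ball of radius $O(h)$. Let $P_0^{[4]}$ be the SIDER4 interpolant constructed from $p_0,p_1,p_2,p_3,p_4$, where $p_j=\gamma(jh)$. Then, uniformly for $0\le\theta\le4$, $$d_{\mathbb{S}^2}\left(\gamma(\theta h),P_0^{[4]}(\theta;h)\right)=O(h^5).$$
   Context: $\mathbb{S}^2=\{x\in\mathbb{R}^3:|x|=1\}$ with the induced Riemannian metric; $d_{\mathbb{S}^2}(y,z)=\arccos(y\cdot z)$. $\operatorname{Exp}_y(v)=\cos|v|\,y+\frac{\sin|v|}{|v|}v$ for $v\in T_y\mathbb{S}^2=\{v\in\mathbb{R}^3:v\cdot y=0\}$ (with $\operatorname{Exp}_y(0)=y$). For $z$ not antipodal to $y$ and $\alpha=\arccos(y\cdot z)$, $\operatorname{Log}_y(z)=\frac{\alpha}{\sin\alpha}(z-(y\cdot z)y)$ (with $\operatorname{Log}_y(y)=0$). For non-antipodal $a,b\in\mathbb{S}^2$ and any real $\lambda$, $\operatorname{SLERP}(a,b,\lambda)=\operatorname{Exp}_a(\lambda\operatorname{Log}_a b)$, equivalently $\frac{\sin((1-\lambda)\alpha)}{\sin\alpha}a+\frac{\sin(\lambda\alpha)}{\sin\alpha}b$ with $\alpha=\arccos(a\cdot b)\in(0,\pi)$. SIDER construction. For a stencil beginning at index $i$, the SIDER2 interpolant is, with $\tau=(\theta-i)/2$, $d_a=\operatorname{SLERP}(p_{i+2},p_{i+1},2)$,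 $d_b=\operatorname{SLERP}(p_i,p_{i+1},2)$, $$P_i^{[2]}(\theta;h)=\operatorname{SLERP}\bigl(\operatorname{SLERP}(p_i,d_a,\tau),\operatorname{SLERP}(d_b,p_{i+2},\tau),\tau\bigr).$$ For $k\ge3$, $P_i^{[k]}(\theta;h)=\operatorname{SLERP}\bigl(P_i^{[k-1]}(\theta;h),P_{i+1}^{[k-1]}(\theta;h),\frac{\theta-i}{k}\bigr)$; SIDER4 is the case $k=4$. Conventions: $\gamma$ is a fixed curve and $h\to0^+$; $h$ is small enough that, in the common geodesically convex ball, logarithms are single-valued and geodesics unique. $O(h^5)$ means bounded by $Ch^5$ for all sufficiently small $h$, with $C$ independent of $h$ and $\theta$. *)

theory Defs
  imports "HOL-Analysis.Analysis"
begin

abbreviation sphere2 :: "(real^3) set" where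
  "sphere2 \<equiv> sphere 0 1"

definition sphere_dist :: "real^3 \<Rightarrow> real^3 \<Rightarrow> real" where
  "sphere_dist y z = arccos (y \<bullet> z)"

definition sphere_Exp :: "real^3 \<Rightarrow> real^3 \<Rightarrow> real^3" where
  "sphere_Exp y v =
     (if v = 0 then y else cos (norm v) *\<^sub>R y + (sin (norm v) / norm v) *\<^sub>R v)"

text \<open>Meaningful only for non-antipodal points of the sphere.\<close>

definition sphere_Log :: "real^3 \<Rightarrow> real^3 \<Rightarrow> real^3" where
  "sphere_Log y z =
     (if z = y then 0
      else (let \<alpha> = arccos (y \<bullet> z) in (\<alpha> / sin \<alpha>) *\<^sub>R (z - (y \<bullet> z) *\<^sub>R y)))"

definition slerp :: "real^3 \<Rightarrow> real^3 \<Rightarrow> real \<Rightarrow> real^3" where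
  "slerp a b t = sphere_Exp a (t *\<^sub>R sphere_Log a b)"

definition sider_da :: "(nat \<Rightarrow> real^3) \<Rightarrow> nat \<Rightarrow> real^3" where
  "sider_da p i = slerp (p (i + 2)) (p (i + 1)) 2"

definition sider_db :: "(nat \<Rightarrow> real^3) \<Rightarrow> nat \<Rightarrow> real^3" where
  "sider_db p i = slerp (p i) (p (i + 1)) 2"

definition sider_left :: "(nat \<Rightarrow> real^3) \<Rightarrow> nat \<Rightarrow> real \<Rightarrow> real^3" where
  "sider_left p i \<theta> = slerp (p i) (sider_da p i) ((\<theta> - real i) / 2)"

definition sider_right :: "(nat \<Rightarrow> real^3) \<Rightarrow> nat \<Rightarrow> real \<Rightarrow> real^3" where
  "sider_right p i \<theta> = slerp (sider_db p i) (p (i + 2)) ((\<theta> - real i) / 2)"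

definition sider2 :: "(nat \<Rightarrow> real^3) \<Rightarrow> nat \<Rightarrow> real \<Rightarrow> real^3" where
  "sider2 p i \<theta> = slerp (sider_left p i \<theta>) (sider_right p i \<theta>) ((\<theta> - real i) / 2)"

text \<open>\<open>sider p k i\<close> is $P_i^{[k]}$ for the data \<open>p\<close>; it is meaningful only for \<open>k \<ge> 2\<close>.\<close>

fun sider :: "(nat \<Rightarrow> real^3) \<Rightarrow> nat \<Rightarrow> nat \<Rightarrow> real \<Rightarrow> real^3" where
  "sider p k i \<theta> =
     (if k \<le> 2 then sider2 p i \<theta>
      else slerp (sider p (k - 1) i \<theta>) (sider p (k - 1) (i + 1) \<theta>) ((\<theta> - real i) / real k))"

declare sider.simps [simp del]

text \<open>
  All points to which an interpolation step is applied in evaluating \<open>sider p 4 0\<close>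
  at parameters in \<open>{0..4}\<close>. The lower-order interpolants are also evaluated
  outside their stencils.
\<close>

definition sider4_points :: "(nat \<Rightarrow> real^3) \<Rightarrow> (real^3) set" where
  "sider4_points p =
     p ` {0..4} \<union> sider_da p ` {0..2} \<union> sider_db p ` {0..2} \<union>
     {sider_left p i \<theta> | i \<theta>. i \<le> 2 \<and> \<theta> \<in> {0..4}} \<union>
     {sider_right p i \<theta> | i \<theta>. i \<le> 2 \<and> \<theta> \<in> {0..4}} \<union>
     {sider p k i \<theta> | k i \<theta>. k \<in> {2, 3} \<and> i + k \<le> 4 \<and> \<theta> \<in> {0..4}}"

definition geodesic_ball :: "real^3 \<Rightarrow> real \<Rightarrow> (real^3) set" where
  "geodesic_ball c r = {z \<in> sphere2. sphere_dist c z < r}"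

text \<open>
  Any two points of \<open>U\<close> are joined by a unique minimizing geodesic (on the sphere: they are
  not antipodal), and this geodesic stays in \<open>U\<close>.
\<close>

definition geodesically_convex :: "(real^3) set \<Rightarrow> bool" where
  "geodesically_convex U \<longleftrightarrow>
     U \<subseteq> sphere2 \<and>
     (\<forall>a\<in>U. \<forall>b\<in>U. b \<noteq> - a \<and> (\<forall>t\<in>{0..1}. slerp a b t \<in> U))"

text \<open>
  Class $C^k$ on \<open>S\<close>. On a closed interval the derivatives at the endpoints are one-sided.
\<close>

definition C_k_on :: "nat \<Rightarrow> (real \<Rightarrow> 'a::real_normed_vector) \<Rightarrow> real set \<Rightarrow> bool" where
  "C_k_on k f S \<longleftrightarrow>
     (\<exists>D :: nat \<Rightarrow> real \<Rightarrow> 'a.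
        (\<forall>t\<in>S. D 0 t = f t) \<and>
        (\<forall>j<k. \<forall>t\<in>S. (D j has_vector_derivative D (Suc j) t) (at t within S)) \<and>
        continuous_on S (D k))"

end

theory Submission
  imports Defs
begin

text \<open>
  Work in the ambient space and, for each SIDER2 stencil, project orthogonally to its middle
  point \<open>Q\<close>.  Since \<open>d\<^sub>a\<close> and \<open>d\<^sub>b\<close> are reflections in \<open>Q\<close>, they project to the negatives of the
  projected data, and the inner geodesics have length \<open>O(h\<^sup>2)\<close>, so they are tangentially affine
  up to \<open>O(h\<^sup>5)\<close>; the outer geodesic contributes one cubic correction.  The normal components
  follow from all points having norm one.  The error of the stencil with index \<open>i\<close> is
  \<open>\<omega>\<^sub>i (h\<^sup>3 A + h\<^sup>4 B\<^sub>i) + O(h\<^sup>5)\<close>, where \<open>\<omega>\<^sub>i\<close> is the nodal cubic, \<open>A\<close> depends neither on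
  \<open>\<theta>\<close> nor on \<open>i\<close>, and \<open>B\<^sub>i\<close> is affine in \<open>\<theta>\<close> and \<open>i\<close>.  The SIDER2 curves are \<open>O(h\<^sup>3)\<close> apart, so
  the last two levels are affine combinations up to \<open>O(h\<^sup>6)\<close>, and the resulting weights
  annihilate \<open>\<omega>\<^sub>i\<close> times any function affine in \<open>\<theta>\<close> and \<open>i\<close>.
\<close>

section \<open>Spherical interpolation between nearby points\<close>

text \<open>A single SIDER2 stencil is only O(h^3) accurate, so the two missing orders must come
  from cancellation between stencils. For that, the error has to be known through its h^4 term, as a
  vector of the fixed space R^3, where contributions from different base points can be combined.
  Both sources of error carry the same factor. With \<mu> = \<theta> - (i + 1), quadratic
  interpolation at the nodes -1, 0, 1 misses x^3 by \<mu> - \<mu>^3 and x^4 by \<mu> times that,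
  while the cubic correction of slerp, written in its centred parameter 2t - 1 = \<mu>, is a
  multiple of \<mu>(1 - \<mu>^2). This is why the nodal cubic splits off. The final cancellation is
  a second difference: the weight of stencil i times its nodal cubic is one common quintic times 1,
  -2, 1 for i = 0, 1, 2. The five derivatives are spent exactly. The h^3 coefficient contains
  derivatives up to the third and can be expanded in the base point to second order; the h^4
  coefficient contains the fourth and is controlled to first order.\<close>

lemma sin_cubic_bound:
  fixes x :: real
  shows "\<bar>sin x - (x - x^3/6)\<bar> \<le> \<bar>x\<bar>^5 / 120"
proof -
  have "{..<5} = {0, 1, 2, 3, 4::nat}" by auto
  then have "(\<Sum>m<5. sin_coeff m * x ^ m) = x - x^3/6"
    by (simp add: sin_coeff_def fact_numeral)
  then show ?thesis
    using Maclaurin_sin_bound[of x 5] by (simp add: fact_numeral)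
qed

lemma one_minus_cos_le:
  fixes x :: real
  shows "1 - cos x \<le> x^2/2"
proof -
  have "cos x = 1 - 2 * sin (x/2)^2"
    using cos_double_sin[of "x/2"] by simp
  moreover have "sin (x/2)^2 \<le> (x/2)^2"
    using abs_sin_x_le_abs_x[of "x/2"] by (metis abs_le_square_iff)
  ultimately show ?thesis by (simp add: power2_eq_square)
qed

lemma sin_ge_cubic:
  fixes x :: real
  assumes "0 \<le> x"
  shows "x - x^3/6 \<le> sin x"
proof -
  have "(\<lambda>x. sin x - (x - x^3/6)) 0 \<le> (\<lambda>x. sin x - (x - x^3/6)) x"
  proof (rule DERIV_nonneg_imp_nondecreasing[OF assms])
    fix y :: real
    assume "0 \<le> y" "y \<le> x"
    have "((\<lambda>x. sin x - (x - x^3/6)) has_real_derivative cos y - (1 - y^2/2)) (at y)"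
      by (auto intro!: derivative_eq_intros simp: power2_eq_square)
    moreover have "0 \<le> cos y - (1 - y^2/2)"
      using one_minus_cos_le[of y] by simp
    ultimately show "\<exists>d. ((\<lambda>x. sin x - (x - x^3/6)) has_real_derivative d) (at y) \<and> 0 \<le> d"
      by blast
  qed
  then show ?thesis by simp
qed

text \<open>Since x - x^3/6 \<ge> x/2 whenever x^2 \<le> 3. It lets angles be replaced by sines,
  hence by chords, at the cost of a factor 2.\<close>

lemma half_le_sin:
  fixes x :: real
  assumes "0 \<le> x" "x \<le> pi/2"
  shows "x/2 \<le> sin x"
proof -
  \<comment> \<open>8/5 is a rational number above pi/2 whose square is still below 3.\<close>
  have "x \<le> 8/5" using assms pi_approx by (simp add: )
  then have "x*x \<le> 8/5 * (8/5)" using assms by (intro mult_mono) auto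
  then have "x * (x*x) \<le> x * 3" using assms by (intro mult_left_mono) auto
  then have "x^3/6 \<le> x/2" by (simp add: power3_eq_cube)
  then show ?thesis using sin_ge_cubic[OF assms(1)] by simp
qed

section \<open>Unit vectors and closed forms of slerp\<close>

lemma norm_diff_unit:
  fixes a b :: "'a::real_inner"
  assumes "norm a = 1" "norm b = 1"
  shows "norm (b - a)^2 = 2 - 2 * (a \<bullet> b)"
proof -
  have "a \<bullet> a = 1" "b \<bullet> b = 1"
    using assms by (simp_all add: dot_square_norm)
  then show ?thesis
    by (simp add: power2_norm_eq_inner inner_diff_left inner_diff_right inner_commute)
qed

lemma unit_inner_bounds:
  fixes a b :: "'a::real_inner"
  assumes "norm a = 1" "norm b = 1"
  shows "-1 \<le> a \<bullet> b" "a \<bullet> b \<le> 1"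
  using Cauchy_Schwarz_ineq2[of a b] assms by auto

lemma unit_inner_strict:
  fixes a b :: "'a::real_inner"
  assumes "norm a = 1" "norm b = 1" "a \<noteq> b" "b \<noteq> -a"
  shows "-1 < a \<bullet> b" "a \<bullet> b < 1"
proof -
  have "norm (b - a) > 0" using assms by simp
  then have "norm (b - a)^2 > 0" by simp
  then show "a \<bullet> b < 1" using norm_diff_unit[OF assms(1,2)] by simp
  have "norm (b + a) > 0"
    using assms(4) by (simp add: add_eq_0_iff2)
  then have "norm (b - (-a))^2 > 0" by simp
  then show "-1 < a \<bullet> b" using norm_diff_unit[of "-a" b] assms by (simp only: norm_minus_cancel inner_minus_left)
qed

lemma unit_close_not_antipodal:
  fixes a b :: "'a::real_normed_vector"
  assumes "norm a = 1" "norm (b - a) \<le> 1"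
  shows "b \<noteq> -a"
proof
  assume "b = -a"
  then have "b - a = -(2 *\<^sub>R a)" by (simp add: scaleR_2)
  then show False using assms by simp
qed

lemma slerp_same: "slerp a a t = a"
  by (simp add: slerp_def sphere_Log_def sphere_Exp_def)

lemma slerp_formula:
  assumes "norm a = 1" "norm b = 1" "a \<noteq> b" "b \<noteq> -a"
  defines "\<alpha> \<equiv> arccos (a \<bullet> b)"
  shows "slerp a b t = (sin ((1 - t) * \<alpha>) / sin \<alpha>) *\<^sub>R a + (sin (t * \<alpha>) / sin \<alpha>) *\<^sub>R b"
proof -
  note ub = unit_inner_strict[OF assms(1-4)]
  have cosa: "cos \<alpha> = a \<bullet> b" using ub by (simp add: \<alpha>_def cos_arccos)
  have apos: "0 < \<alpha>" "\<alpha> < pi" using ub arccos_lt_bounded[of "a \<bullet> b"] by (auto simp: \<alpha>_def)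
  then have spos: "0 < sin \<alpha>" by (simp add: sin_gt_zero)
  define w where "w = b - (a \<bullet> b) *\<^sub>R a"
  have aa: "a \<bullet> a = 1" and bb: "b \<bullet> b = 1"
    using assms(1,2) by (simp_all add: dot_square_norm)
  have "norm w ^ 2 = 1 - (a \<bullet> b)^2"
    unfolding w_def power2_norm_eq_inner
    by (simp add: power2_eq_square inner_diff_left inner_diff_right aa bb inner_commute)
  also have "\<dots> = sin \<alpha> ^ 2" using sin_cos_squared_add[of \<alpha>] cosa by simp
  finally have nw: "norm w = sin \<alpha>"
    using spos by (auto intro!: power2_eq_imp_eq[OF _ norm_ge_zero])
  have Log: "sphere_Log a b = (\<alpha> / sin \<alpha>) *\<^sub>R w"
    using assms(3) by (simp add: sphere_Log_def \<alpha>_def w_def Let_def)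
  let ?v = "(t * (\<alpha> / sin \<alpha>)) *\<^sub>R w"
  have nv: "norm ?v = \<bar>t\<bar> * \<alpha>" using nw apos spos by (simp add: abs_mult)
  have "slerp a b t = cos (t * \<alpha>) *\<^sub>R a + (sin (t * \<alpha>) / sin \<alpha>) *\<^sub>R w"
  proof (cases "t = 0")
    case True then show ?thesis by (simp add: slerp_def sphere_Exp_def)
  next
    case False
    then have "?v \<noteq> 0" using apos nv by (metis mult_eq_0_iff abs_eq_0 less_irrefl norm_zero)
    then have "slerp a b t = cos (\<bar>t\<bar> * \<alpha>) *\<^sub>R a + (sin (\<bar>t\<bar> * \<alpha>) / (\<bar>t\<bar> * \<alpha>)) *\<^sub>R ?v"
      using nv by (simp add: slerp_def sphere_Exp_def Log)
    \<comment> \<open>\<open>sphere_Exp\<close> sees only the length |t| \<alpha> of the velocity.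
      Evenness of cos and oddness of sin restore the sign of t, which can be negative when a stencil
      is evaluated outside its nodes.\<close>
    also have "cos (\<bar>t\<bar> * \<alpha>) = cos (t * \<alpha>)"
      by (cases "t < 0") auto
    also have "(sin (\<bar>t\<bar> * \<alpha>) / (\<bar>t\<bar> * \<alpha>)) *\<^sub>R ?v = (sin (t * \<alpha>) / sin \<alpha>) *\<^sub>R w"
      using False apos by (cases "t < 0") auto
    finally show ?thesis .
  qed
  also have "\<dots> = (cos (t * \<alpha>) - sin (t * \<alpha>) / sin \<alpha> * cos \<alpha>) *\<^sub>R a + (sin (t * \<alpha>) / sin \<alpha>) *\<^sub>R b"
    by (simp add: w_def cosa algebra_simps)
  also have "cos (t * \<alpha>) - sin (t * \<alpha>) / sin \<alpha> * cos \<alpha> = sin ((1 - t) * \<alpha>) / sin \<alpha>"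
    using spos by (simp add: left_diff_distrib sin_diff field_simps)
  finally show ?thesis .
qed

text \<open>From sin(-\<alpha>)/sin \<alpha> = -1 and sin(2\<alpha>)/sin \<alpha> = 2 cos \<alpha>.
  Being polynomial in a and b, this form makes the projections of the reflected points
  exact.\<close>

lemma slerp_2:
  assumes "norm a = 1" "norm b = 1" "b \<noteq> -a"
  shows "slerp a b 2 = (2 * (a \<bullet> b)) *\<^sub>R b - a"
proof (cases "a = b")
  case True
  then show ?thesis using assms by (simp add: slerp_same dot_square_norm scaleR_2)
next
  case False
  note ub = unit_inner_strict[OF assms(1,2) False assms(3)]
  have cosa: "cos (arccos (a \<bullet> b)) = a \<bullet> b" using ub by (simp add: cos_arccos)
  have spos: "0 < sin (arccos (a \<bullet> b))"
    using ub arccos_lt_bounded[of "a \<bullet> b"] by (auto intro: sin_gt_zero)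
  show ?thesis
    using spos by (simp add: slerp_formula[OF assms(1,2) False assms(3)] sin_double cosa)
qed

text \<open>Centring the parameter at 1/2 splits the geodesic into an even part along a + b and an
  odd part along b - a, which are orthogonal. With \<beta> half the angle the chord is exactly 2 sin
  \<beta>, so the coefficients can be expanded in the squared chord.\<close>

lemma slerp_midpoint_form:
  assumes "norm a = 1" "norm b = 1" "a \<noteq> b" "b \<noteq> -a"
  obtains \<beta> where "0 < \<beta>" "\<beta> < pi/2" "norm (b - a) = 2 * sin \<beta>" "norm (a + b) = 2 * cos \<beta>"
    "\<And>t. slerp a b t = (cos ((2*t - 1) * \<beta>) / cos \<beta>) *\<^sub>R ((a + b) /\<^sub>R 2)
        + (sin ((2*t - 1) * \<beta>) / sin \<beta>) *\<^sub>R ((b - a) /\<^sub>R 2)"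
proof -
  note ub = unit_inner_strict[OF assms(1-4)]
  define \<beta> where "\<beta> = arccos (a \<bullet> b) / 2"
  have cosa: "cos (2 * \<beta>) = a \<bullet> b" using ub by (simp add: \<beta>_def cos_arccos)
  have bpos: "0 < \<beta>" "\<beta> < pi/2" using ub arccos_lt_bounded[of "a \<bullet> b"] by (auto simp: \<beta>_def)
  have s: "0 < sin \<beta>" and c: "0 < cos \<beta>"
    using bpos by (auto intro: sin_gt_zero cos_gt_zero)
  have "norm (b - a)^2 = (2 * sin \<beta>)^2"
    using cosa cos_double_sin[of \<beta>] by (simp add: norm_diff_unit[OF assms(1,2)] power_mult_distrib)
  then have 1: "norm (b - a) = 2 * sin \<beta>" using s by (auto intro!: power2_eq_imp_eq[OF _ norm_ge_zero])
  have "norm (b + a)^2 = (2 * cos \<beta>)^2"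
    using cosa cos_double_cos[of \<beta>] norm_diff_unit[of "-a" b] assms by (simp add: power_mult_distrib)
  then have 2: "norm (a + b) = 2 * cos \<beta>" using c by (auto simp: add.commute intro: power2_eq_imp_eq[where x="norm (a + b)"])
  have 3: "slerp a b t = (cos ((2*t - 1) * \<beta>) / cos \<beta>) *\<^sub>R ((a + b) /\<^sub>R 2)
        + (sin ((2*t - 1) * \<beta>) / sin \<beta>) *\<^sub>R ((b - a) /\<^sub>R 2)" for t
  proof -
    have e: "arccos (a \<bullet> b) = 2 * \<beta>" by (simp add: \<beta>_def)
    define m where "m = (2*t - 1) * \<beta>"
    have x: "(1 - t) * (2 * \<beta>) = \<beta> - m" "t * (2 * \<beta>) = \<beta> + m"
      by (simp_all add: m_def algebra_simps)
    have A: "sin (\<beta> - m) / sin (2 * \<beta>) = (cos m / cos \<beta>) / 2 - (sin m / sin \<beta>) / 2"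
      using s c unfolding sin_diff sin_double by (simp add: field_simps)
    have B: "sin (\<beta> + m) / sin (2 * \<beta>) = (cos m / cos \<beta>) / 2 + (sin m / sin \<beta>) / 2"
      using s c unfolding sin_add sin_double by (simp add: field_simps)
    have C: "(X / 2 - Y / 2) *\<^sub>R a + (X / 2 + Y / 2) *\<^sub>R b
        = X *\<^sub>R ((a + b) /\<^sub>R 2) + Y *\<^sub>R ((b - a) /\<^sub>R 2)" for X Y :: real
      by (simp add: vec_eq_iff field_simps)
    show ?thesis
      unfolding slerp_formula[OF assms(1-4)] e x A B m_def[symmetric] by (rule C)
  qed
  show thesis using that bpos 1 2 3 by blast
qed

lemma norm_slerp:
  assumes "norm a = 1" "norm b = 1" "b \<noteq> -a"
  shows "norm (slerp a b t) = 1"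
proof (cases "a = b")
  case True
  then show ?thesis using assms by (simp add: slerp_same)
next
  case False
  obtain \<beta> where b: "0 < \<beta>" "\<beta> < pi/2" "norm (b - a) = 2 * sin \<beta>" "norm (a + b) = 2 * cos \<beta>"
    and f: "\<And>t. slerp a b t = (cos ((2*t - 1) * \<beta>) / cos \<beta>) *\<^sub>R ((a + b) /\<^sub>R 2)
        + (sin ((2*t - 1) * \<beta>) / sin \<beta>) *\<^sub>R ((b - a) /\<^sub>R 2)"
    using slerp_midpoint_form[OF assms(1,2) False assms(3)] by blast
  have s: "0 < sin \<beta>" and c: "0 < cos \<beta>"
    using b by (auto intro: sin_gt_zero cos_gt_zero)
  have "(a + b) \<bullet> (b - a) = 0"
    using assms by (simp add: inner_add_left inner_add_right inner_diff_left inner_diff_right inner_commute dot_square_norm)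
  then have "norm (slerp a b t)^2 = norm ((cos ((2*t - 1) * \<beta>) / cos \<beta>) *\<^sub>R ((a + b) /\<^sub>R 2))^2
        + norm ((sin ((2*t - 1) * \<beta>) / sin \<beta>) *\<^sub>R ((b - a) /\<^sub>R 2))^2"
    unfolding f by (intro norm_add_Pythagorean) (simp add: orthogonal_def)
  also have "\<dots> = cos ((2*t - 1) * \<beta>)^2 + sin ((2*t - 1) * \<beta>)^2"
    using b(3,4) s c by (simp add: power_mult_distrib power_divide)
  finally show ?thesis by (simp add: power2_eq_1_iff) (smt (verit) norm_ge_zero)
qed

section \<open>Expansion of slerp in powers of the chord\<close>

text \<open>Inserting \<beta> = sin \<beta> + (sin \<beta>)^3/6 + ... into \<mu>\<beta> -
  (\<mu>\<beta>)^3/6 gives the cubic coefficient \<mu>(1 - \<mu>^2)/6. It vanishes at the midpoint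
  \<mu> = 0 and at the end points \<mu> = -1, 1. The variable is sin \<beta>, as this is half the
  chord.\<close>

lemma sin_ratio_bound:
  fixes \<mu> \<beta> :: real
  assumes "0 < \<beta>" "\<beta> < pi/2" "\<bar>\<mu>\<bar> \<le> 3"
  shows "\<bar>sin (\<mu> * \<beta>) / sin \<beta> - (\<mu> + \<mu> * (1 - \<mu>^2) / 6 * sin \<beta>^2)\<bar> \<le> 192 * sin \<beta>^4"
proof -
  have s: "0 < sin \<beta>" using assms by (auto intro: sin_gt_zero)
  have h: "\<beta> \<le> 2 * sin \<beta>" using half_le_sin[of \<beta>] assms by simp
  have mu: "\<bar>\<mu>\<bar>^k \<le> 3^k" for k using assms(3) by (intro power_mono) auto
  have 1: "\<bar>sin (\<mu> * \<beta>) - (\<mu> * \<beta> - (\<mu> * \<beta>)^3/6)\<bar> \<le> 243/120 * \<beta>^5"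
  proof -
    have "\<bar>\<mu> * \<beta>\<bar>^5 \<le> 3^5 * \<beta>^5"
      using mu[of 5] assms(1) by (simp add: abs_mult power_mult_distrib mult_right_mono)
    then show ?thesis using sin_cubic_bound[of "\<mu> * \<beta>"] by simp
  qed
  have 2: "\<bar>\<mu> * (sin \<beta> - (\<beta> - \<beta>^3/6))\<bar> \<le> 3 * (\<beta>^5/120)"
    using sin_cubic_bound[of \<beta>] assms by (simp only: abs_mult) (intro mult_mono, auto)
  have 3: "\<bar>\<mu> * (1 - \<mu>^2) / 6 * (\<beta>^3 - sin \<beta>^3)\<bar> \<le> 5 * (\<beta>^5/2)"
  proof -
    have sb: "sin \<beta> \<le> \<beta>" using assms by (simp add: sin_x_le_x)
    have "\<beta>^3 - sin \<beta>^3 = (\<beta> - sin \<beta>) * (\<beta>^2 + \<beta> * sin \<beta> + sin \<beta>^2)"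
      by (simp add: power2_eq_square power3_eq_cube algebra_simps)
    also have "\<dots> \<le> (\<beta>^3/6) * (\<beta>*\<beta> + \<beta>*\<beta> + \<beta>*\<beta>)"
      using sin_ge_cubic[of \<beta>] assms sb s unfolding power2_eq_square
      by (intro mult_mono add_mono) auto
    also have "\<dots> = \<beta>^5/2" by (simp add: eval_nat_numeral)
    finally have u: "\<beta>^3 - sin \<beta>^3 \<le> \<beta>^5/2" .
    have l: "0 \<le> \<beta>^3 - sin \<beta>^3" using sb s by (simp add: power_mono)
    have "\<bar>\<mu> * (1 - \<mu>^2) / 6\<bar> \<le> 3 * 10 / 6"
    proof -
      have "\<bar>1 - \<mu>^2\<bar> \<le> 10" using mu[of 2] by (simp add: abs_le_iff) (smt (verit) zero_le_power2)
      then have "\<bar>\<mu>\<bar> * \<bar>1 - \<mu>^2\<bar> \<le> 3 * 10" using assms by (intro mult_mono) auto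
      then show ?thesis by (simp add: abs_mult)
    qed
    then have "\<bar>\<mu> * (1 - \<mu>^2) / 6\<bar> * \<bar>\<beta>^3 - sin \<beta>^3\<bar> \<le> 5 * (\<beta>^5/2)"
      using u l by (intro mult_mono) auto
    then show ?thesis by (simp add: abs_mult)
  qed
  have "sin (\<mu> * \<beta>) - (\<mu> * sin \<beta> + \<mu> * (1 - \<mu>^2) / 6 * sin \<beta>^3)
      = (sin (\<mu> * \<beta>) - (\<mu> * \<beta> - (\<mu> * \<beta>)^3/6)) - \<mu> * (sin \<beta> - (\<beta> - \<beta>^3/6))
        + \<mu> * (1 - \<mu>^2) / 6 * (\<beta>^3 - sin \<beta>^3)"
    by (simp add: power2_eq_square power3_eq_cube field_simps)
  then have "\<bar>sin (\<mu> * \<beta>) - (\<mu> * sin \<beta> + \<mu> * (1 - \<mu>^2) / 6 * sin \<beta>^3)\<bar> \<le> 6 * \<beta>^5"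
    using 1 2 3 zero_le_power[of \<beta> 5] assms(1) by linarith
  \<comment> \<open>The three remainders add up to less than 5 \<beta>^5. The passage to sines costs
    2^5, whence 192 = 6 * 32.\<close>
  also have "6 * \<beta>^5 \<le> 6 * (2 * sin \<beta>)^5"
    using h assms by (intro mult_left_mono power_mono) auto
  also have "\<dots> = 192 * sin \<beta>^4 * sin \<beta>" by (simp add: power_mult_distrib eval_nat_numeral)
  finally have main: "\<bar>sin (\<mu> * \<beta>) - (\<mu> * sin \<beta> + \<mu> * (1 - \<mu>^2) / 6 * sin \<beta>^3)\<bar> \<le> 192 * sin \<beta>^4 * sin \<beta>" .
  have "sin (\<mu> * \<beta>) / sin \<beta> - (\<mu> + \<mu> * (1 - \<mu>^2) / 6 * sin \<beta>^2)
     = (sin (\<mu> * \<beta>) - (\<mu> * sin \<beta> + \<mu> * (1 - \<mu>^2) / 6 * sin \<beta>^3)) / sin \<beta>"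
    using s by (simp add: field_simps power2_eq_square power3_eq_cube)
  then show ?thesis using main s by (simp add: divide_le_eq)
qed

text \<open>Second order is enough: in the projected estimates this coefficient multiplies the
  projected midpoint, which is small itself. The bound on sin \<beta> keeps cos \<beta> at least
  1/2.\<close>

lemma cos_ratio_bound:
  fixes \<mu> \<beta> :: real
  assumes "0 < \<beta>" "\<beta> < pi/2" "\<bar>\<mu>\<bar> \<le> 3" "sin \<beta> \<le> 1/2"
  shows "\<bar>cos (\<mu> * \<beta>) / cos \<beta> - 1\<bar> \<le> 40 * sin \<beta>^2"
proof -
  have s: "0 < sin \<beta>" and c: "0 < cos \<beta>"
    using assms by (auto intro: sin_gt_zero cos_gt_zero)
  have h: "\<beta> \<le> 2 * sin \<beta>" using half_le_sin[of \<beta>] assms by simp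
  have "sin \<beta> ^2 \<le> (1/2)^2" using s assms(4) by (intro power_mono) auto
  then have "(1/2)^2 \<le> cos \<beta>^2" using sin_cos_squared_add[of \<beta>] by (simp add: power2_eq_square)
  then have c2: "1/2 \<le> cos \<beta>" using c by (meson less_imp_le power2_le_imp_le)
  have "\<bar>\<mu>\<bar>^2 \<le> 3^2" using assms(3) by (intro power_mono) auto
  then have "\<mu>^2 * \<beta>^2 \<le> 9 * \<beta>^2" by (intro mult_right_mono) auto
  then have "\<bar>cos (\<mu> * \<beta>) - cos \<beta>\<bar> \<le> 5 * \<beta>^2"
    using one_minus_cos_le[of "\<mu> * \<beta>"] one_minus_cos_le[of \<beta>] cos_le_one[of \<beta>] cos_le_one[of "\<mu> * \<beta>"]
    by (simp only: abs_le_iff power_mult_distrib) linarith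
  also have "\<dots> \<le> 5 * (2 * sin \<beta>)^2"
    using h assms by (intro mult_left_mono power_mono) auto
  also have "\<dots> = 40 * sin \<beta>^2 * (1/2)" by (simp add: power_mult_distrib)
  also have "\<dots> \<le> 40 * sin \<beta>^2 * cos \<beta>"
    using c2 by (intro mult_left_mono) auto
  finally have "\<bar>cos (\<mu> * \<beta>) - cos \<beta>\<bar> \<le> 40 * sin \<beta>^2 * cos \<beta>" .
  moreover have "cos (\<mu> * \<beta>) / cos \<beta> - 1 = (cos (\<mu> * \<beta>) - cos \<beta>) / cos \<beta>"
    using c by (simp add: field_simps)
  ultimately show ?thesis using c by (simp add: divide_le_eq)
qed

text \<open>With f applied before norms are taken, the errors are weighted by the images of midpoint
  and half chord instead of by vectors of norm about one; for f a tangential projection this gains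
  the decisive orders. The range of t covers (\<theta> - i)/2 for i \<le> 2 and \<theta> in [0, 4].
  The constants are those of the two ratio bounds with sin \<beta> = |b - a|/2.\<close>

lemma slerp_expansion:
  fixes f :: "real^3 \<Rightarrow> 'a::real_normed_vector"
  assumes "norm a = 1" "norm b = 1" "norm (b - a) \<le> 1" "-1 \<le> t" "t \<le> 2" "linear f"
  defines "\<mu> \<equiv> 2 * t - 1"
  shows "norm (f (slerp a b t) - f ((a + b) /\<^sub>R 2)
            - (\<mu> + \<mu> * (1 - \<mu>^2) / 24 * norm (b - a)^2) *\<^sub>R f ((b - a) /\<^sub>R 2))
          \<le> 10 * norm (b - a)^2 * norm (f ((a + b) /\<^sub>R 2)) + 12 * norm (b - a)^4 * norm (f ((b - a) /\<^sub>R 2))"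
proof (cases "a = b")
  case True
  have "(a + a) /\<^sub>R 2 = a" by (simp flip: scaleR_2)
  then show ?thesis using True linear_0[OF assms(6)] by (simp add: slerp_same)
next
  case False
  have nb: "b \<noteq> -a" using assms(1,3) by (rule unit_close_not_antipodal)
  obtain \<beta> where b: "0 < \<beta>" "\<beta> < pi/2" "norm (b - a) = 2 * sin \<beta>"
    and f: "\<And>t. slerp a b t = (cos ((2*t - 1) * \<beta>) / cos \<beta>) *\<^sub>R ((a + b) /\<^sub>R 2)
        + (sin ((2*t - 1) * \<beta>) / sin \<beta>) *\<^sub>R ((b - a) /\<^sub>R 2)"
    using slerp_midpoint_form[OF assms(1,2) False nb] by blast
  have mu: "\<bar>\<mu>\<bar> \<le> 3" using assms by auto
  define k where "k = cos (\<mu> * \<beta>) / cos \<beta> - 1"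
  define m where "m = sin (\<mu> * \<beta>) / sin \<beta> - (\<mu> + \<mu> * (1 - \<mu>^2) / 6 * sin \<beta>^2)"
  have kb: "\<bar>k\<bar> \<le> 10 * norm (b - a)^2"
    using cos_ratio_bound[OF b(1,2) mu] b(3) assms(3) by (simp add: k_def power_mult_distrib)
  have mb: "\<bar>m\<bar> \<le> 12 * norm (b - a)^4"
    using sin_ratio_bound[OF b(1,2) mu] b(3) by (simp add: m_def power_mult_distrib)
  have c24: "\<mu> * (1 - \<mu>^2) / 24 * norm (b - a)^2 = \<mu> * (1 - \<mu>^2) / 6 * sin \<beta>^2"
    unfolding b(3) by (simp add: power_mult_distrib)
  have "slerp a b t = (1 + k) *\<^sub>R ((a + b) /\<^sub>R 2)
     + (\<mu> + \<mu> * (1 - \<mu>^2) / 24 * norm (b - a)^2 + m) *\<^sub>R ((b - a) /\<^sub>R 2)"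
    unfolding f c24 by (simp add: k_def m_def \<mu>_def)
  then have "f (slerp a b t) = (1 + k) *\<^sub>R f ((a + b) /\<^sub>R 2)
     + (\<mu> + \<mu> * (1 - \<mu>^2) / 24 * norm (b - a)^2 + m) *\<^sub>R f ((b - a) /\<^sub>R 2)"
    by (simp only: linear_add[OF assms(6)] linear_cmul[OF assms(6)])
  then have "f (slerp a b t) - f ((a + b) /\<^sub>R 2)
            - (\<mu> + \<mu> * (1 - \<mu>^2) / 24 * norm (b - a)^2) *\<^sub>R f ((b - a) /\<^sub>R 2)
     = k *\<^sub>R f ((a + b) /\<^sub>R 2) + m *\<^sub>R f ((b - a) /\<^sub>R 2)"
    by (simp only: scaleR_add_left scaleR_one) simp
  also have "norm \<dots> \<le> \<bar>k\<bar> * norm (f ((a + b) /\<^sub>R 2)) + \<bar>m\<bar> * norm (f ((b - a) /\<^sub>R 2))"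
    by (metis norm_scaleR norm_triangle_ineq)
  also have "\<dots> \<le> 10 * norm (b - a)^2 * norm (f ((a + b) /\<^sub>R 2)) + 12 * norm (b - a)^4 * norm (f ((b - a) /\<^sub>R 2))"
    using kb mb by (intro add_mono mult_right_mono) auto
  finally show ?thesis .
qed

text \<open>The expansion for the identity map. The midpoint now has norm about one, so its cosine
  coefficient limits the order to two; for points O(h^3) apart that still means O(h^6).\<close>

lemma slerp_near_affine:
  assumes "norm a = 1" "norm b = 1" "norm (b - a) \<le> 1" "-1 \<le> t" "t \<le> 2"
  shows "norm (slerp a b t - ((1 - t) *\<^sub>R a + t *\<^sub>R b)) \<le> 30 * norm (b - a)^2"
proof -
  define \<mu> where "\<mu> = 2 * t - 1"
  define d where "d = norm (b - a)"
  define c where "c = \<mu> * (1 - \<mu>^2) / 24 * d^2"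
  have mu: "\<bar>\<mu>\<bar> \<le> 3" using assms by (auto simp: \<mu>_def)
  have d: "0 \<le> d" "d \<le> 1" using assms by (auto simp: d_def)
  define S where "S = (a + b) /\<^sub>R 2"
  define D where "D = (b - a) /\<^sub>R 2"
  have nS: "norm S \<le> 1" using norm_triangle_ineq[of a b] assms by (simp add: S_def)
  have nD: "norm D = d/2" by (simp add: D_def d_def)
  have e: "norm (slerp a b t - S - (\<mu> + c) *\<^sub>R D) \<le> 10 * d^2 * norm S + 12 * d^4 * norm D"
    using slerp_expansion[OF assms(1-5) linear_id] by (simp add: \<mu>_def d_def S_def D_def c_def)
  have "\<mu>^2 \<le> 3^2" using mu by (metis abs_le_square_iff abs_numeral)
  then have "\<bar>1 - \<mu>^2\<bar> \<le> 10" by (simp add: abs_le_iff) (smt (verit) zero_le_power2)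
  then have "\<bar>\<mu>\<bar> * \<bar>1 - \<mu>^2\<bar> \<le> 3 * 10" using mu by (intro mult_mono) auto
  then have "\<bar>\<mu> * (1 - \<mu>^2) / 24\<bar> \<le> 2" by (simp add: abs_mult)
  then have "\<bar>c\<bar> \<le> 2 * d^2" unfolding c_def abs_mult by (simp add: mult_right_mono abs_mult)
  then have cD: "norm (c *\<^sub>R D) \<le> 2 * d^2 * 1"
    unfolding norm_scaleR nD using d by (intro mult_mono) auto
  have aff: "(1 - t) *\<^sub>R a + t *\<^sub>R b = S + \<mu> *\<^sub>R D"
    by (simp add: S_def D_def \<mu>_def vec_eq_iff field_simps)
  have "slerp a b t - ((1 - t) *\<^sub>R a + t *\<^sub>R b) = (slerp a b t - S - (\<mu> + c) *\<^sub>R D) + c *\<^sub>R D"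
    unfolding aff by (simp add: algebra_simps)
  then have "norm (slerp a b t - ((1 - t) *\<^sub>R a + t *\<^sub>R b))
      \<le> norm (slerp a b t - S - (\<mu> + c) *\<^sub>R D) + norm (c *\<^sub>R D)"
    by (simp only: norm_triangle_ineq)
  then have "norm (slerp a b t - ((1 - t) *\<^sub>R a + t *\<^sub>R b)) \<le> 10 * d^2 * norm S + 12 * d^4 * norm D + 2 * d^2"
    using e cD by linarith
  also have "10 * d^2 * norm S \<le> 10 * d^2 * 1" using nS by (intro mult_left_mono) auto
  also have "12 * d^4 * norm D \<le> 12 * d^2 * 1"
    using d nD by (intro mult_mono mult_left_mono power_decreasing) auto
  finally show ?thesis using d by (simp add: d_def[symmetric]) (smt (verit) zero_le_power2)
qed

text \<open>The arc is 2 \<beta> and the chord 2 sin \<beta>, and \<beta> \<le> 2 sin \<beta> up to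
  pi/2. This carries the final estimate from R^3 back to the sphere.\<close>

lemma sphere_dist_le_chord:
  assumes "norm a = 1" "norm b = 1"
  shows "sphere_dist a b \<le> 2 * norm (b - a)"
proof -
  note ub = unit_inner_bounds[OF assms]
  define \<beta> where "\<beta> = arccos (a \<bullet> b) / 2"
  have cosa: "cos (2 * \<beta>) = a \<bullet> b" using ub by (simp add: \<beta>_def cos_arccos)
  have bpos: "0 \<le> \<beta>" "\<beta> \<le> pi/2" using ub arccos_bounded[of "a \<bullet> b"] by (auto simp: \<beta>_def)
  have s: "0 \<le> sin \<beta>" using bpos by (simp add: sin_ge_zero)
  have "norm (b - a)^2 = (2 * sin \<beta>)^2"
    using cosa cos_double_sin[of \<beta>] by (simp add: norm_diff_unit[OF assms(1,2)] power_mult_distrib)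
  then have 1: "norm (b - a) = 2 * sin \<beta>" using s by (auto intro!: power2_eq_imp_eq[OF _ norm_ge_zero])
  show ?thesis using half_le_sin[OF bpos] unfolding 1 sphere_dist_def by (simp add: \<beta>_def)
qed

section \<open>Uniform asymptotics in the step size\<close>

text \<open>Every quantity is a function of both h and \<theta>, even if it depends on one of them
  only, so that a single calculus covers constants, powers of h and curves. The quantifier over
  \<theta> stands inside the eventuality, which is the uniformity.\<close>

definition unif_O :: "nat \<Rightarrow> (real \<Rightarrow> real \<Rightarrow> 'a::real_normed_vector) \<Rightarrow> bool" where
  "unif_O n f \<longleftrightarrow> (\<exists>C. \<forall>\<^sub>F h in at_right 0. \<forall>\<theta>\<in>{0..4}. norm (f h \<theta>) \<le> C * h ^ n)"

lemma eventually_small: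
  fixes e :: real
  assumes "e > 0"
  shows "\<forall>\<^sub>F h in at_right 0. 0 < h \<and> h < e"
  using eventually_at_right_real[OF assms] by (auto elim: eventually_mono)

lemma unif_O_E:
  assumes "unif_O n f"
  obtains C where "C > 0"
    "\<forall>\<^sub>F h in at_right 0. 0 < h \<and> h < 1 \<and> (\<forall>\<theta>\<in>{0..4}. norm (f h \<theta>) \<le> C * h ^ n)"
proof -
  obtain C where C: "\<forall>\<^sub>F h in at_right 0. \<forall>\<theta>\<in>{0..4}. norm (f h \<theta>) \<le> C * h ^ n"
    using assms by (auto simp: unif_O_def)
  have "\<forall>\<^sub>F h in at_right 0. 0 < h \<and> h < 1 \<and> (\<forall>\<theta>\<in>{0..4}. norm (f h \<theta>) \<le> (\<bar>C\<bar> + 1) * h ^ n)"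
    using C eventually_small[OF zero_less_one]
  proof eventually_elim
    case (elim h)
    then have "C * h ^ n \<le> (\<bar>C\<bar> + 1) * h ^ n" by (intro mult_right_mono) auto
    then show ?case using elim order_trans by blast
  qed
  then show thesis using that[of "\<bar>C\<bar> + 1"] by simp
qed

lemma unif_O_I:
  assumes "\<forall>\<^sub>F h in at_right 0. \<forall>\<theta>\<in>{0..4}. norm (f h \<theta>) \<le> C * h ^ n"
  shows "unif_O n f"
  using assms by (auto simp: unif_O_def)

text \<open>Equality is asked for small h only, because facts about the curve hold only while the
  sampled parameters stay in the domain.\<close>

lemma unif_O_cong:
  assumes "unif_O n g" "\<forall>\<^sub>F h in at_right 0. \<forall>\<theta>\<in>{0..4}. f h \<theta> = g h \<theta>"
  shows "unif_O n f"
proof -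
  obtain C where "\<forall>\<^sub>F h in at_right 0. \<forall>\<theta>\<in>{0..4}. norm (g h \<theta>) \<le> C * h ^ n"
    using assms(1) by (auto simp: unif_O_def)
  then have "\<forall>\<^sub>F h in at_right 0. \<forall>\<theta>\<in>{0..4}. norm (f h \<theta>) \<le> C * h ^ n"
    using assms(2) by eventually_elim auto
  then show ?thesis by (rule unif_O_I)
qed

lemma unif_O_mono:
  assumes "unif_O m f" "n \<le> m"
  shows "unif_O n f"
proof -
  obtain C where "C > 0"
    and C: "\<forall>\<^sub>F h in at_right 0. 0 < h \<and> h < 1 \<and> (\<forall>\<theta>\<in>{0..4}. norm (f h \<theta>) \<le> C * h ^ m)"
    using assms(1) by (rule unif_O_E)
  from C have "\<forall>\<^sub>F h in at_right 0. \<forall>\<theta>\<in>{0..4}. norm (f h \<theta>) \<le> C * h ^ n"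
  proof eventually_elim
    case (elim h)
    then have "C * h ^ m \<le> C * h ^ n"
      using assms(2) \<open>C > 0\<close> by (intro mult_left_mono power_decreasing) auto
    then show ?case using elim by force
  qed
  then show ?thesis by (rule unif_O_I)
qed

lemma unif_O_add:
  assumes "unif_O n f" "unif_O n g"
  shows "unif_O n (\<lambda>h \<theta>. f h \<theta> + g h \<theta>)"
proof -
  obtain C where C: "\<forall>\<^sub>F h in at_right 0. \<forall>\<theta>\<in>{0..4}. norm (f h \<theta>) \<le> C * h ^ n"
    using assms(1) by (auto simp: unif_O_def)
  obtain D where D: "\<forall>\<^sub>F h in at_right 0. \<forall>\<theta>\<in>{0..4}. norm (g h \<theta>) \<le> D * h ^ n"
    using assms(2) by (auto simp: unif_O_def)
  from C D have "\<forall>\<^sub>F h in at_right 0. \<forall>\<theta>\<in>{0..4}. norm (f h \<theta> + g h \<theta>) \<le> (C + D) * h ^ n"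
    by eventually_elim (auto simp: distrib_right intro!: order_trans[OF norm_triangle_ineq] add_mono)
  then show ?thesis by (rule unif_O_I)
qed

lemma unif_O_minus: "unif_O n f \<Longrightarrow> unif_O n (\<lambda>h \<theta>. - f h \<theta>)"
  by (simp add: unif_O_def)

lemma unif_O_diff:
  assumes "unif_O n f" "unif_O n g"
  shows "unif_O n (\<lambda>h \<theta>. f h \<theta> - g h \<theta>)"
  using unif_O_add[OF assms(1) unif_O_minus[OF assms(2)]] by simp

lemma unif_O_norm: "unif_O n f \<Longrightarrow> unif_O n (\<lambda>h \<theta>. norm (f h \<theta>))"
  by (simp add: unif_O_def)

lemma unif_O_bilinear:
  assumes "bounded_bilinear pr" "unif_O m f" "unif_O n g" "k \<le> m + n"
  shows "unif_O k (\<lambda>h \<theta>. pr (f h \<theta>) (g h \<theta>))"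
proof -
  obtain K where K: "K > 0" "\<And>a b. norm (pr a b) \<le> norm a * norm b * K"
    using bounded_bilinear.pos_bounded[OF assms(1)] by blast
  obtain C where "C > 0"
    and C: "\<forall>\<^sub>F h in at_right 0. 0 < h \<and> h < 1 \<and> (\<forall>\<theta>\<in>{0..4}. norm (f h \<theta>) \<le> C * h ^ m)"
    using assms(2) by (rule unif_O_E)
  obtain D where "D > 0"
    and D: "\<forall>\<^sub>F h in at_right 0. 0 < h \<and> h < 1 \<and> (\<forall>\<theta>\<in>{0..4}. norm (g h \<theta>) \<le> D * h ^ n)"
    using assms(3) by (rule unif_O_E)
  from C D have "\<forall>\<^sub>F h in at_right 0. \<forall>\<theta>\<in>{0..4}. norm (pr (f h \<theta>) (g h \<theta>)) \<le> (C * D * K) * h ^ (m + n)"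
  proof eventually_elim
    case (elim h)
    show ?case
    proof
      fix \<theta> :: real assume t: "\<theta> \<in> {0..4}"
      have "norm (pr (f h \<theta>) (g h \<theta>)) \<le> norm (f h \<theta>) * norm (g h \<theta>) * K" by (rule K)
      also have "\<dots> \<le> (C * h ^ m) * (D * h ^ n) * K"
        using elim t K \<open>C > 0\<close> by (intro mult_right_mono mult_mono) auto
      also have "\<dots> = (C * D * K) * h ^ (m + n)" by (simp add: power_add)
      finally show "norm (pr (f h \<theta>) (g h \<theta>)) \<le> (C * D * K) * h ^ (m + n)" .
    qed
  qed
  then have "unif_O (m + n) (\<lambda>h \<theta>. pr (f h \<theta>) (g h \<theta>))" by (rule unif_O_I)
  then show ?thesis using assms(4) by (rule unif_O_mono)
qed

lemmas unif_O_scaleR = unif_O_bilinear[OF bounded_bilinear_scaleR]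
lemmas unif_O_inner = unif_O_bilinear[OF bounded_bilinear_inner]
lemmas unif_O_mult = unif_O_bilinear[OF bounded_bilinear_mult]

lemma unif_O_theta:
  assumes "continuous_on {0..4} g"
  shows "unif_O 0 (\<lambda>h \<theta>. g \<theta>)"
proof -
  have "bounded (g ` {0..4})"
    using assms by (intro compact_imp_bounded compact_continuous_image) auto
  then obtain C where "\<forall>\<theta>\<in>{0..4}. norm (g \<theta>) \<le> C" by (auto simp: bounded_iff)
  then show ?thesis by (intro unif_O_I[of _ C]) auto
qed

lemma unif_O_const: "unif_O 0 (\<lambda>h \<theta>. c)"
  by (intro unif_O_theta continuous_intros)

lemma unif_O_power: "unif_O n (\<lambda>h \<theta>. h ^ n)"
proof (rule unif_O_I[of _ 1])
  show "\<forall>\<^sub>F h in at_right 0. \<forall>\<theta>\<in>{0..4}. norm (h ^ n) \<le> 1 * h ^ n"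
    using eventually_small[OF zero_less_one] by eventually_elim auto
qed

lemma unif_O_eventually_le:
  assumes "unif_O n f" "0 < n" "0 < e"
  shows "\<forall>\<^sub>F h in at_right 0. \<forall>\<theta>\<in>{0..4}. norm (f h \<theta>) \<le> e"
proof -
  have "unif_O 1 f" using assms by (intro unif_O_mono[OF assms(1)]) auto
  then obtain C where "C > 0"
    and C: "\<forall>\<^sub>F h in at_right 0. 0 < h \<and> h < 1 \<and> (\<forall>\<theta>\<in>{0..4}. norm (f h \<theta>) \<le> C * h ^ 1)"
    by (rule unif_O_E)
  have "e / C > 0" using \<open>C > 0\<close> assms by simp
  from C eventually_small[OF this] show ?thesis
  proof eventually_elim
    case (elim h)
    then have "C * h ^ 1 \<le> e" using \<open>C > 0\<close> by (simp add: field_simps)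
    then show ?case using elim by force
  qed
qed

lemma unif_O_le:
  assumes "unif_O n g" "\<forall>\<^sub>F h in at_right 0. \<forall>\<theta>\<in>{0..4}. norm (f h \<theta>) \<le> norm (g h \<theta>)"
  shows "unif_O n f"
proof -
  obtain C where "\<forall>\<^sub>F h in at_right 0. \<forall>\<theta>\<in>{0..4}. norm (g h \<theta>) \<le> C * h ^ n"
    using assms(1) by (auto simp: unif_O_def)
  then have "\<forall>\<^sub>F h in at_right 0. \<forall>\<theta>\<in>{0..4}. norm (f h \<theta>) \<le> C * h ^ n"
    using assms(2) by eventually_elim force
  then show ?thesis by (rule unif_O_I)
qed

section \<open>Slerp within the asymptotic calculus\<close>

definition eventually_unit :: "(real \<Rightarrow> real \<Rightarrow> 'a::real_normed_vector) \<Rightarrow> bool" where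
  "eventually_unit f \<longleftrightarrow> (\<forall>\<^sub>F h in at_right 0. \<forall>\<theta>\<in>{0..4}. norm (f h \<theta>) = 1)"

lemma eventually_unit_unif_O: "eventually_unit f \<Longrightarrow> unif_O 0 f"
  unfolding eventually_unit_def by (intro unif_O_I[of _ 1]) (auto elim: eventually_mono)

text \<open>Chords that tend to zero are eventually at most 1, and antipodal unit vectors have
  distance 2.\<close>

lemma eventually_unit_slerp:
  assumes "eventually_unit a" "eventually_unit b" "unif_O n (\<lambda>h \<theta>. b h \<theta> - a h \<theta>)" "0 < n"
  shows "eventually_unit (\<lambda>h \<theta>. slerp (a h \<theta>) (b h \<theta>) (t \<theta>))"
  using assms(1,2) unif_O_eventually_le[OF assms(3,4) zero_less_one] unfolding eventually_unit_def
  by eventually_elim (metis norm_slerp unit_close_not_antipodal)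

lemma unif_O_slerp_affine:
  assumes "eventually_unit a" "eventually_unit b" "unif_O n (\<lambda>h \<theta>. b h \<theta> - a h \<theta>)" "0 < n"
    and t: "\<And>\<theta>. \<theta> \<in> {0..4} \<Longrightarrow> -1 \<le> t \<theta> \<and> t \<theta> \<le> 2"
    and "k \<le> 2 * n"
  shows "unif_O k (\<lambda>h \<theta>. slerp (a h \<theta>) (b h \<theta>) (t \<theta>) - ((1 - t \<theta>) *\<^sub>R a h \<theta> + t \<theta> *\<^sub>R b h \<theta>))"
proof -
  let ?d = "\<lambda>h \<theta>. norm (b h \<theta> - a h \<theta>)"
  have "unif_O k (\<lambda>h \<theta>. 30 * (?d h \<theta> * ?d h \<theta>))"
    using assms(3,6)
    by (intro unif_O_mult[OF unif_O_const, of k] unif_O_mult[of n _ n] unif_O_norm) auto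
  then show ?thesis
  proof (rule unif_O_le)
    show "\<forall>\<^sub>F h in at_right 0. \<forall>\<theta>\<in>{0..4}.
      norm (slerp (a h \<theta>) (b h \<theta>) (t \<theta>) - ((1 - t \<theta>) *\<^sub>R a h \<theta> + t \<theta> *\<^sub>R b h \<theta>))
        \<le> norm (30 * (?d h \<theta> * ?d h \<theta>))"
      using assms(1,2) unif_O_eventually_le[OF assms(3,4) zero_less_one] unfolding eventually_unit_def
    proof eventually_elim
      case (elim h)
      show ?case
      proof
        fix \<theta> :: real assume th: "\<theta> \<in> {0..4}"
        show "norm (slerp (a h \<theta>) (b h \<theta>) (t \<theta>) - ((1 - t \<theta>) *\<^sub>R a h \<theta> + t \<theta> *\<^sub>R b h \<theta>))
          \<le> norm (30 * (?d h \<theta> * ?d h \<theta>))"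
          using slerp_near_affine[of "a h \<theta>" "b h \<theta>" "t \<theta>"] elim th t[OF th]
          by (simp add: power2_eq_square)
      qed
    qed
  qed
qed

text \<open>The two bounds on k are the orders of the two error terms of
  \<open>slerp_expansion\<close>: squared chord times projected midpoint, and fourth power of the
  chord times projected half chord.\<close>

lemma unif_O_slerp_linear:
  fixes f :: "real \<Rightarrow> real^3 \<Rightarrow> 'a::real_normed_vector"
  assumes "eventually_unit a" "eventually_unit b" "unif_O n (\<lambda>h \<theta>. b h \<theta> - a h \<theta>)" "0 < n"
    and t: "\<And>\<theta>. \<theta> \<in> {0..4} \<Longrightarrow> -1 \<le> t \<theta> \<and> t \<theta> \<le> 2"
    and lin: "\<And>h. linear (f h)"
    and p: "unif_O p (\<lambda>h \<theta>. f h ((a h \<theta> + b h \<theta>) /\<^sub>R 2))"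
    and q: "unif_O q (\<lambda>h \<theta>. f h ((b h \<theta> - a h \<theta>) /\<^sub>R 2))"
    and k: "k \<le> 2 * n + p" "k \<le> 4 * n + q"
  defines "\<mu> \<equiv> \<lambda>\<theta>. 2 * t \<theta> - 1"
  shows "unif_O k (\<lambda>h \<theta>. f h (slerp (a h \<theta>) (b h \<theta>) (t \<theta>)) - f h ((a h \<theta> + b h \<theta>) /\<^sub>R 2)
    - (\<mu> \<theta> + \<mu> \<theta> * (1 - (\<mu> \<theta>)^2) / 24 * norm (b h \<theta> - a h \<theta>)^2) *\<^sub>R f h ((b h \<theta> - a h \<theta>) /\<^sub>R 2))"
proof -
  let ?d = "\<lambda>h \<theta>. norm (b h \<theta> - a h \<theta>)"
  let ?S = "\<lambda>h \<theta>. norm (f h ((a h \<theta> + b h \<theta>) /\<^sub>R 2))"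
  let ?D = "\<lambda>h \<theta>. norm (f h ((b h \<theta> - a h \<theta>) /\<^sub>R 2))"
  have d: "unif_O n ?d" using assms(3) by (rule unif_O_norm)
  have d2: "unif_O (2*n) (\<lambda>h \<theta>. ?d h \<theta> * ?d h \<theta>)" by (rule unif_O_mult[OF d d]) simp
  have d4: "unif_O (4*n) (\<lambda>h \<theta>. (?d h \<theta> * ?d h \<theta>) * (?d h \<theta> * ?d h \<theta>))"
    by (rule unif_O_mult[OF d2 d2]) simp
  have "unif_O k (\<lambda>h \<theta>. 10 * ((?d h \<theta> * ?d h \<theta>) * ?S h \<theta>) + 12 * (((?d h \<theta> * ?d h \<theta>) * (?d h \<theta> * ?d h \<theta>)) * ?D h \<theta>))"
    by (intro unif_O_add unif_O_mult[OF unif_O_const, of k]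
        unif_O_mult[OF d2 unif_O_norm[OF p]] unif_O_mult[OF d4 unif_O_norm[OF q]]) (use k in auto)
  then show ?thesis
  proof (rule unif_O_le)
    show "\<forall>\<^sub>F h in at_right 0. \<forall>\<theta>\<in>{0..4}.
      norm (f h (slerp (a h \<theta>) (b h \<theta>) (t \<theta>)) - f h ((a h \<theta> + b h \<theta>) /\<^sub>R 2)
    - (\<mu> \<theta> + \<mu> \<theta> * (1 - (\<mu> \<theta>)^2) / 24 * norm (b h \<theta> - a h \<theta>)^2) *\<^sub>R f h ((b h \<theta> - a h \<theta>) /\<^sub>R 2))
        \<le> norm (10 * ((?d h \<theta> * ?d h \<theta>) * ?S h \<theta>) + 12 * (((?d h \<theta> * ?d h \<theta>) * (?d h \<theta> * ?d h \<theta>)) * ?D h \<theta>))"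
      using assms(1,2) unif_O_eventually_le[OF assms(3,4) zero_less_one] unfolding eventually_unit_def
    proof eventually_elim
      case (elim h)
      show ?case
      proof
        fix \<theta> :: real assume th: "\<theta> \<in> {0..4}"
        have "norm (f h (slerp (a h \<theta>) (b h \<theta>) (t \<theta>)) - f h ((a h \<theta> + b h \<theta>) /\<^sub>R 2)
    - (\<mu> \<theta> + \<mu> \<theta> * (1 - (\<mu> \<theta>)^2) / 24 * norm (b h \<theta> - a h \<theta>)^2) *\<^sub>R f h ((b h \<theta> - a h \<theta>) /\<^sub>R 2))
       \<le> 10 * ?d h \<theta>^2 * ?S h \<theta> + 12 * ?d h \<theta>^4 * ?D h \<theta>"
          using slerp_expansion[of "a h \<theta>" "b h \<theta>" "t \<theta>", OF _ _ _ _ _ lin] elim th t[OF th]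
          by (simp add: \<mu>_def)
        also have "\<dots> = 10 * ((?d h \<theta> * ?d h \<theta>) * ?S h \<theta>) + 12 * (((?d h \<theta> * ?d h \<theta>) * (?d h \<theta> * ?d h \<theta>)) * ?D h \<theta>)"
          by (simp add: power2_eq_square power4_eq_xxxx)
        also have "\<dots> \<le> norm \<dots>" by simp
        finally show "norm (f h (slerp (a h \<theta>) (b h \<theta>) (t \<theta>)) - f h ((a h \<theta> + b h \<theta>) /\<^sub>R 2)
    - (\<mu> \<theta> + \<mu> \<theta> * (1 - (\<mu> \<theta>)^2) / 24 * norm (b h \<theta> - a h \<theta>)^2) *\<^sub>R f h ((b h \<theta> - a h \<theta>) /\<^sub>R 2))
        \<le> norm (10 * ((?d h \<theta> * ?d h \<theta>) * ?S h \<theta>) + 12 * (((?d h \<theta> * ?d h \<theta>) * (?d h \<theta> * ?d h \<theta>)) * ?D h \<theta>))" .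
      qed
    qed
  qed
qed

section \<open>Taylor expansion\<close>

text \<open>Vector values admit no Lagrange remainder, so the mean value inequality along the
  segment is used inductively: the derivative of the remainder of order n + 1 is the remainder of
  order n of the shifted family. This loses the factor 1/n!, harmless for orders in h.\<close>

lemma vector_Taylor_bound:
  fixes D :: "nat \<Rightarrow> real \<Rightarrow> 'a::real_normed_vector"
  assumes "convex S"
    and "\<And>j t. j < n \<Longrightarrow> t \<in> S \<Longrightarrow> (D j has_vector_derivative D (Suc j) t) (at t within S)"
    and "\<And>t. t \<in> S \<Longrightarrow> norm (D n t) \<le> M" and "x \<in> S" "y \<in> S"
  shows "norm (D 0 y - (\<Sum>m<n. ((y - x)^m / fact m) *\<^sub>R D m x)) \<le> M * \<bar>y - x\<bar>^n"
  using assms(2-5)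
proof (induction n arbitrary: D y)
  case 0
  then show ?case by simp
next
  case (Suc n)
  have M: "0 \<le> M" using Suc.prems(2)[OF Suc.prems(3)] norm_ge_zero order_trans by blast
  define r where "r z = D 0 z - (\<Sum>m<Suc n. ((z - x)^m / fact m) *\<^sub>R D m x)" for z
  define r' where "r' z = D 1 z - (\<Sum>m<n. ((z - x)^m / fact m) *\<^sub>R D (Suc m) x)" for z
  have seg: "closed_segment x y \<subseteq> S"
    using Suc.prems(3,4) assms(1) by (simp add: closed_segment_subset)
  have "(r has_vector_derivative r' z) (at z within S)" if z: "z \<in> S" for z
  proof -
    have 1: "(D 0 has_vector_derivative D 1 z) (at z within S)"
      using Suc.prems(1)[of 0 z] z by simp
    have 2: "((\<lambda>z. ((z - x)^Suc m / fact (Suc m)) *\<^sub>R D (Suc m) x) has_vector_derivative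
        ((z - x)^m / fact m) *\<^sub>R D (Suc m) x) (at z within S)" for m
    proof -
      have "((\<lambda>z. (z - x)^Suc m / fact (Suc m)) has_real_derivative (z - x)^m / fact m) (at z within S)"
        by (rule derivative_eq_intros refl | simp)+
      then show ?thesis by (rule has_vector_derivative_scaleR[THEN has_vector_derivative_eq_rhs])
          (auto intro: derivative_eq_intros)
    qed
    have r: "r = (\<lambda>z. D 0 z - (D 0 x + (\<Sum>m<n. ((z - x)^Suc m / fact (Suc m)) *\<^sub>R D (Suc m) x)))"
      unfolding r_def by (subst sum.lessThan_Suc_shift) simp
    show ?thesis
      unfolding r r'_def
      by (rule has_vector_derivative_diff[OF 1, THEN has_vector_derivative_eq_rhs])
        (rule has_vector_derivative_add[OF has_vector_derivative_const has_vector_derivative_sum[OF 2]], simp)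
  qed
  then have der: "(r has_derivative (\<lambda>s. s *\<^sub>R r' z)) (at z within closed_segment x y)"
    if "z \<in> closed_segment x y" for z
    using that seg has_derivative_subset unfolding has_vector_derivative_def by blast
  have bound: "onorm (\<lambda>s. s *\<^sub>R r' z) \<le> M * \<bar>y - x\<bar>^n" if z: "z \<in> closed_segment x y" for z
  proof (rule onorm_le)
    fix s :: real
    have "norm (r' z) \<le> M * \<bar>z - x\<bar>^n"
      using Suc.IH[of "\<lambda>j. D (Suc j)" z] Suc.prems z seg by (auto simp: r'_def)
    also have "\<dots> \<le> M * \<bar>y - x\<bar>^n"
      using z M by (intro mult_left_mono power_mono)
        (auto simp: closed_segment_eq_real_ivl split: if_splits)
    finally show "norm (s *\<^sub>R r' z) \<le> M * \<bar>y - x\<bar>^n * norm s"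
      by (simp add: mult.commute[of "norm s"] mult.commute[of _ "\<bar>s\<bar>"] mult_left_mono)
  qed
  have "norm (r y - r x) \<le> M * \<bar>y - x\<bar>^n * norm (y - x)"
    using der bound by (rule differentiable_bound[OF convex_closed_segment]) auto
  moreover have "r x = 0"
    unfolding r_def by (subst sum.lessThan_Suc_shift) simp
  ultimately have "norm (r y) \<le> M * \<bar>y - x\<bar> ^ Suc n" by (simp add: mult_ac)
  then show ?case unfolding r_def .
qed

text \<open>For n = 1 this is a Lipschitz bound at 0, for n = 2 a first-order Taylor expansion
  there. It serves to replace coefficients taken at the middle node of each stencil by one expansion
  at 0 common to all stencils, and unlike differentiability it comes with explicit remainders that
  are easily multiplied.\<close>

definition affine_upto :: "nat \<Rightarrow> real \<Rightarrow> (real \<Rightarrow> 'a::real_normed_vector) \<Rightarrow> bool" where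
  "affine_upto n T f \<longleftrightarrow> (\<exists>c d C. \<forall>x\<in>{0..T}. norm (f x - c - x *\<^sub>R d) \<le> C * x^n)"

lemma affine_upto_add:
  assumes "affine_upto n T f" "affine_upto n T g"
  shows "affine_upto n T (\<lambda>x. f x + g x)"
proof -
  obtain c d C where 1: "\<forall>x\<in>{0..T}. norm (f x - c - x *\<^sub>R d) \<le> C * x^n"
    using assms(1) by (auto simp: affine_upto_def)
  obtain c' d' C' where 2: "\<forall>x\<in>{0..T}. norm (g x - c' - x *\<^sub>R d') \<le> C' * x^n"
    using assms(2) by (auto simp: affine_upto_def)
  have "norm (f x + g x - (c + c') - x *\<^sub>R (d + d')) \<le> (C + C') * x^n" if "x \<in> {0..T}" for x
  proof -
    have "f x + g x - (c + c') - x *\<^sub>R (d + d') = (f x - c - x *\<^sub>R d) + (g x - c' - x *\<^sub>R d')"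
      by (simp add: algebra_simps)
    also have "norm \<dots> \<le> C * x^n + C' * x^n"
      using 1 2 that by (intro order_trans[OF norm_triangle_ineq] add_mono) auto
    finally show ?thesis by (simp add: distrib_right)
  qed
  then show ?thesis unfolding affine_upto_def by blast
qed

lemma affine_upto_const: "affine_upto n T (\<lambda>x. c)"
  unfolding affine_upto_def
  by (rule exI[of _ c], rule exI[of _ 0], rule exI[of _ 0]) simp

text \<open>The restriction n \<le> 2 comes from the product of the two linear terms, which is
  quadratic and must fit into the remainder.\<close>

lemma affine_upto_bilinear:
  assumes "bounded_bilinear pr" "affine_upto n T f" "affine_upto n T g" "n \<le> 2"
  shows "affine_upto n T (\<lambda>x. pr (f x) (g x))"
proof -
  interpret bounded_bilinear pr by fact
  obtain K where K: "K > 0" "\<And>a b. norm (pr a b) \<le> norm a * norm b * K"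
    using pos_bounded by blast
  obtain c d C where 1: "\<forall>x\<in>{0..T}. norm (f x - c - x *\<^sub>R d) \<le> C * x^n"
    using assms(2) by (auto simp: affine_upto_def)
  obtain c' d' C' where 2: "\<forall>x\<in>{0..T}. norm (g x - c' - x *\<^sub>R d') \<le> C' * x^n"
    using assms(3) by (auto simp: affine_upto_def)
  define M where "M = norm c + T * norm d"
  define M' where "M' = norm c' + T * norm d' + \<bar>C'\<bar> * T^n"
  have "norm (pr (f x) (g x) - pr c c' - x *\<^sub>R (pr d c' + pr c d'))
      \<le> (C * M' * K + M * C' * K + (1 + T)^2 * (norm d * norm d' * K)) * x^n" if x: "x \<in> {0..T}" for x
  proof -
    have nb: "norm (c + x *\<^sub>R d) \<le> M"
      unfolding M_def using x
      by (intro order_trans[OF norm_triangle_ineq] add_mono) (auto intro: mult_right_mono)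
    have C0: "0 \<le> C * x^n" "0 \<le> C' * x^n" using 1 2 x norm_ge_zero order_trans by blast+
    have "C' * x^n \<le> \<bar>C'\<bar> * T^n" using x by (intro mult_mono power_mono) auto
    then have r: "norm (g x - c' - x *\<^sub>R d') \<le> \<bar>C'\<bar> * T^n" using 2 x by force
    have "norm (c' + x *\<^sub>R d') \<le> norm c' + T * norm d'"
      using x by (intro order_trans[OF norm_triangle_ineq] add_mono) (auto intro: mult_right_mono)
    then have ng: "norm (g x) \<le> M'"
      using r norm_triangle_ineq[of "c' + x *\<^sub>R d'" "g x - c' - x *\<^sub>R d'"] by (simp add: M'_def)
    have e1: "norm (pr (f x - c - x *\<^sub>R d) (g x)) \<le> (C * x^n) * M' * K"
      using 1 x ng K C0 by (intro order_trans[OF K(2)] mult_right_mono mult_mono) auto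
    have e2: "norm (pr (c + x *\<^sub>R d) (g x - c' - x *\<^sub>R d')) \<le> M * (C' * x^n) * K"
      using 2 x nb K C0 order_trans[OF norm_ge_zero nb] by (intro order_trans[OF K(2)] mult_right_mono mult_mono) auto
    \<comment> \<open>On {0..T} the surplus power of x is bounded, and the crude constant (1 + T)^2
      works for every n \<le> 2, whether T is below or above 1.\<close>
    have "x^2 = x^n * x^(2-n)" using assms(4) by (simp flip: power_add)
    also have "\<dots> \<le> x^n * (1 + T)^(2-n)" using x by (intro mult_left_mono power_mono) auto
    also have "\<dots> \<le> x^n * (1 + T)^2" using x by (intro mult_left_mono power_increasing) auto
    finally have x2: "x^2 \<le> (1 + T)^2 * x^n" by (simp add: mult.commute)
    have e3: "norm (x^2 *\<^sub>R pr d d') \<le> ((1 + T)^2 * x^n) * (norm d * norm d' * K)"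
      unfolding norm_scaleR using x2 K x by (intro mult_mono) auto
    have "pr (f x) (g x) - pr c c' - x *\<^sub>R (pr d c' + pr c d')
        = pr (f x - c - x *\<^sub>R d) (g x) + pr (c + x *\<^sub>R d) (g x - c' - x *\<^sub>R d') + x^2 *\<^sub>R pr d d'"
      by (simp add: add_left add_right diff_left diff_right scaleR_left scaleR_right
          algebra_simps power2_eq_square)
    also have "norm \<dots> \<le> (C * x^n) * M' * K + M * (C' * x^n) * K + ((1 + T)^2 * x^n) * (norm d * norm d' * K)"
      using e1 e2 e3 by (intro order_trans[OF norm_triangle_ineq] add_mono)
    finally show ?thesis by (simp add: algebra_simps)
  qed
  then show ?thesis unfolding affine_upto_def by blast
qed

lemmas affine_upto_scaleR = affine_upto_bilinear[OF bounded_bilinear_scaleR]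
lemmas affine_upto_mult = affine_upto_bilinear[OF bounded_bilinear_mult]
lemmas affine_upto_inner = affine_upto_bilinear[OF bounded_bilinear_inner]

lemma affine_upto_diff:
  assumes "affine_upto n T f" "affine_upto n T g" "n \<le> 2"
  shows "affine_upto n T (\<lambda>x. f x - g x)"
  using affine_upto_add[OF assms(1) affine_upto_scaleR[OF affine_upto_const[of _ _ "-1"] assms(2,3)]]
  by simp

text \<open>The point is the order of quantifiers: the same c and d serve every k, hence every
  stencil.\<close>

lemma affine_upto_unif_O:
  assumes "affine_upto n T f" "0 < T"
  obtains c d where
    "\<And>k. 0 \<le> k \<Longrightarrow> unif_O n (\<lambda>h \<theta>. f (k * h) - c - (k * h) *\<^sub>R d)"
proof -
  obtain c d C where 1: "\<forall>x\<in>{0..T}. norm (f x - c - x *\<^sub>R d) \<le> C * x^n"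
    using assms(1) by (auto simp: affine_upto_def)
  have "unif_O n (\<lambda>h \<theta>. f (k * h) - c - (k * h) *\<^sub>R d)" if "0 \<le> k" for k
  proof (rule unif_O_I[of _ "C * k^n"])
    have "0 < T / (k + 1)" using assms that by simp
    from eventually_small[OF this]
    show "\<forall>\<^sub>F h in at_right 0. \<forall>\<theta>\<in>{0..4}. norm (f (k * h) - c - (k * h) *\<^sub>R d) \<le> C * k^n * h^n"
    proof eventually_elim
      case (elim h)
      then have "k * h \<le> T" using that by (simp add: field_simps)
      then have "norm (f (k * h) - c - (k * h) *\<^sub>R d) \<le> C * (k * h)^n"
        using 1 that elim by auto
      then show ?case by (simp add: power_mult_distrib)
    qed
  qed
  then show thesis using that by blast
qed

lemma unif_O_pow_scaleR:
  assumes "unif_O 0 f" "n \<le> m"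
  shows "unif_O n (\<lambda>h \<theta>. h ^ m *\<^sub>R f h \<theta>)"
  using assms by (intro unif_O_scaleR[OF unif_O_power assms(1)]) simp

lemma unif_O_pow_mult:
  assumes "unif_O 0 f" "n \<le> m"
  shows "unif_O n (\<lambda>h \<theta>. h ^ m * f h \<theta>)"
  using unif_O_pow_scaleR[OF assms] by simp

lemma unif_O_bounded_inner: "unif_O 0 f \<Longrightarrow> unif_O 0 g \<Longrightarrow> unif_O 0 (\<lambda>h \<theta>. f h \<theta> \<bullet> g h \<theta>)"
  by (rule unif_O_inner) auto

lemma unif_O_bounded_scaleR:
  "unif_O 0 f \<Longrightarrow> unif_O n g \<Longrightarrow> unif_O n (\<lambda>h \<theta>. f h \<theta> *\<^sub>R g h \<theta>)"
  by (rule unif_O_scaleR) auto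

lemma unif_O_bounded_mult:
  "unif_O 0 f \<Longrightarrow> unif_O n g \<Longrightarrow> unif_O n (\<lambda>h \<theta>. f h \<theta> * g h \<theta> :: real)"
  by (rule unif_O_mult) auto

text \<open>For unit vectors 1 - a . b is half the squared chord, so normal defects have twice the
  order of the distance.\<close>

lemma unif_O_one_minus_inner:
  fixes a b :: "real \<Rightarrow> real \<Rightarrow> 'a::real_inner"
  assumes "eventually_unit a" "eventually_unit b" "unif_O n (\<lambda>h \<theta>. b h \<theta> - a h \<theta>)" "m \<le> 2 * n"
  shows "unif_O m (\<lambda>h \<theta>. 1 - a h \<theta> \<bullet> b h \<theta>)"
proof (rule unif_O_cong)
  show "unif_O m (\<lambda>h \<theta>. (1/2) * ((b h \<theta> - a h \<theta>) \<bullet> (b h \<theta> - a h \<theta>)))"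
    using assms(4) by (intro unif_O_bounded_mult unif_O_const unif_O_inner[OF assms(3,3)]) simp
  show "\<forall>\<^sub>F h in at_right 0. \<forall>\<theta>\<in>{0..4}. 1 - a h \<theta> \<bullet> b h \<theta> = (1/2) * ((b h \<theta> - a h \<theta>) \<bullet> (b h \<theta> - a h \<theta>))"
    using assms(1,2) unfolding eventually_unit_def
  proof eventually_elim
    case (elim h)
    then show ?case using norm_diff_unit[of "a h _" "b h _"]
      by (simp add: power2_norm_eq_inner)
  qed
qed

lemma unif_O_theta_scaleR:
  "continuous_on {0..4} c \<Longrightarrow> unif_O n f \<Longrightarrow> unif_O n (\<lambda>h \<theta>. c \<theta> *\<^sub>R f h \<theta>)"
  by (intro unif_O_bounded_scaleR unif_O_theta)

section \<open>Interpolation of a curve on the sphere\<close>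

locale sphere_curve =
  fixes \<gamma> :: "real \<Rightarrow> real^3" and T :: real and D :: "nat \<Rightarrow> real \<Rightarrow> real^3"
  assumes T_pos: "0 < T"
    and D_0: "t \<in> {0..T} \<Longrightarrow> D 0 t = \<gamma> t"
    and D_Suc: "j < 5 \<Longrightarrow> t \<in> {0..T} \<Longrightarrow> (D j has_vector_derivative D (Suc j) t) (at t within {0..T})"
    and cont_D5: "continuous_on {0..T} (D 5)"
    and norm_curve: "t \<in> {0..T} \<Longrightarrow> norm (\<gamma> t) = 1"
begin

section \<open>Taylor and error coefficients along the curve\<close>

definition taylor_coeff :: "nat \<Rightarrow> real \<Rightarrow> real^3" where
  "taylor_coeff m x = (1 / fact m) *\<^sub>R D m x"

text \<open>The base point \<open>taylor_coeff 0 x\<close> is \<gamma> at x for x in the domain. The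
  map is linear for every x, but the orthogonal projection onto the tangent plane only where this
  vector has norm one.\<close>

definition tangent_proj :: "real \<Rightarrow> real^3 \<Rightarrow> real^3" where
  "tangent_proj x v = v - (taylor_coeff 0 x \<bullet> v) *\<^sub>R taylor_coeff 0 x"

definition tangent_coeff :: "nat \<Rightarrow> real \<Rightarrow> real^3" where
  "tangent_coeff m x = tangent_proj x (taylor_coeff m x)"

text \<open>The first term is the error of quadratic interpolation, the second the cubic correction
  of the outer geodesic. They cancel on a great circle run at constant speed, where the third
  tangential coefficient is -1/6 |a|^2 a with a the velocity.\<close>

definition cubic_error :: "real \<Rightarrow> real^3" where
  "cubic_error x = tangent_coeff 3 x + ((1/6) * (tangent_coeff 1 x \<bullet> tangent_coeff 1 x)) *\<^sub>R tangent_coeff 1 x"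

text \<open>The terms before the last are the tangential h^4 coefficient, with the same two sources
  as \<open>cubic_error\<close>. The last one points along the base point; it is the normal
  displacement that unit length forces upon a tangential error.\<close>

definition quartic_error :: "real \<Rightarrow> real^3" where
  "quartic_error x = tangent_coeff 4 x + (1/6) *\<^sub>R ((2 * (tangent_coeff 1 x \<bullet> tangent_coeff 2 x)) *\<^sub>R tangent_coeff 1 x + (tangent_coeff 1 x \<bullet> tangent_coeff 1 x) *\<^sub>R tangent_coeff 2 x)
     - (cubic_error x \<bullet> tangent_coeff 1 x) *\<^sub>R taylor_coeff 0 x"

lemma continuous_D:
  assumes "m \<le> 5"
  shows "continuous_on {0..T} (D m)"
proof (cases "m = 5")
  case False
  then have "m < 5" using assms by simp
  then show ?thesis
    using D_Suc has_vector_derivative_continuous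
    by (fastforce simp: continuous_on_eq_continuous_within)
qed (use cont_D5 in simp)

lemma bounded_D:
  assumes "m \<le> 5"
  obtains M where "\<And>x. x \<in> {0..T} \<Longrightarrow> norm (D m x) \<le> M"
proof -
  have "bounded (D m ` {0..T})"
    using continuous_D[OF assms] by (intro compact_imp_bounded compact_continuous_image) auto
  then show thesis unfolding bounded_iff using that by (metis imageI)
qed

lemma eventually_in_domain:
  assumes "0 \<le> k"
  shows "\<forall>\<^sub>F h in at_right 0. 0 < h \<and> k * h \<in> {0..T}"
proof -
  have "0 < T / (k + 1)" using T_pos assms by simp
  from eventually_small[OF this] show ?thesis
  proof eventually_elim
    case (elim h)
    then have "k * h \<le> T" using assms by (simp add: field_simps)
    then show ?case using elim assms by simp
  qed
qed

lemma unif_O_taylor_coeff: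
  assumes "m \<le> 5" "0 \<le> k"
  shows "unif_O 0 (\<lambda>h \<theta>. taylor_coeff m (k * h))"
proof -
  obtain M where M: "\<And>x. x \<in> {0..T} \<Longrightarrow> norm (D m x) \<le> M" using bounded_D[OF assms(1)] by blast
  have "unif_O 0 (\<lambda>h \<theta>. D m (k * h))"
    using eventually_in_domain[OF assms(2)]
    by (intro unif_O_I[of _ M]) (auto elim!: eventually_mono intro: M)
  then show ?thesis unfolding taylor_coeff_def by (rule unif_O_bounded_scaleR[OF unif_O_const])
qed

lemma unif_O_tangent_proj:
  assumes "unif_O n f" "0 \<le> k"
  shows "unif_O n (\<lambda>h \<theta>. tangent_proj (k * h) (f h \<theta>))"
  unfolding tangent_proj_def
  using assms by (intro unif_O_diff unif_O_scaleR[of n _ 0] unif_O_inner[of 0 _ n] unif_O_taylor_coeff) auto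

lemma linear_tangent_proj: "linear (tangent_proj x)"
  by (rule linearI) (simp_all add: tangent_proj_def inner_add_right algebra_simps)

lemmas tangent_proj_simps = linear_add[OF linear_tangent_proj] linear_diff[OF linear_tangent_proj] linear_cmul[OF linear_tangent_proj]
  linear_neg[OF linear_tangent_proj] linear_0[OF linear_tangent_proj]

lemma unif_O_tangent_coeff:
  assumes "m \<le> 5" "0 \<le> k"
  shows "unif_O 0 (\<lambda>h \<theta>. tangent_coeff m (k * h))"
  unfolding tangent_coeff_def using assms by (intro unif_O_tangent_proj unif_O_taylor_coeff)

lemma affine_upto_D:
  assumes "n \<in> {1,2}" "m + n \<le> 5"
  shows "affine_upto n T (D m)"
proof -
  obtain M where M: "\<And>x. x \<in> {0..T} \<Longrightarrow> norm (D (m + n) x) \<le> M" using bounded_D[OF assms(2)] by blast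
  have "norm (D m y - (\<Sum>j<n. (y^j / fact j) *\<^sub>R D (m + j) 0)) \<le> M * y^n" if "y \<in> {0..T}" for y
    using vector_Taylor_bound[of "{0..T}" n "\<lambda>j. D (m + j)" M 0 y] D_Suc M that T_pos assms(2) by simp
  moreover have "(\<Sum>j<n. (y^j / fact j) *\<^sub>R D (m + j) 0)
      = D m 0 + y *\<^sub>R (if n = 2 then D (m + 1) 0 else 0)" for y
    using assms(1) by (auto simp: numeral_2_eq_2)
  ultimately show ?thesis unfolding affine_upto_def
    by (intro exI[of _ "D m 0"] exI[of _ "if n = 2 then D (m + 1) 0 else 0"] exI[of _ M]) (auto simp: algebra_simps)
qed

lemma affine_upto_tangent_coeff:
  assumes "n \<in> {1,2}" "m + n \<le> 5"
  shows "affine_upto n T (tangent_coeff m)"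
proof -
  have q: "affine_upto n T (taylor_coeff j)" if "j + n \<le> 5" for j
    unfolding taylor_coeff_def using assms(1) that
    by (intro affine_upto_scaleR affine_upto_const affine_upto_D) auto
  show ?thesis
    unfolding tangent_coeff_def[abs_def] tangent_proj_def using assms
    by (intro affine_upto_diff affine_upto_scaleR affine_upto_inner q) auto
qed

text \<open>Only derivatives up to the third occur, so two more are available for the expansion at
  0.\<close>

lemma affine_upto_cubic_error: "n \<in> {1,2} \<Longrightarrow> affine_upto n T cubic_error"
  unfolding cubic_error_def[abs_def]
  by (intro affine_upto_add affine_upto_scaleR affine_upto_mult affine_upto_inner
      affine_upto_const affine_upto_tangent_coeff) auto

text \<open>The fourth derivative occurs, which leaves one derivative and hence order 1. Behind the
  factor h^4 this yields O(h^5).\<close>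

lemma affine_upto_quartic_error: "affine_upto 1 T quartic_error"
proof -
  have "affine_upto 1 T (taylor_coeff 0)"
    unfolding taylor_coeff_def
    by (intro affine_upto_scaleR affine_upto_const affine_upto_D) auto
  then show ?thesis
    unfolding quartic_error_def[abs_def]
    by (intro affine_upto_add affine_upto_diff affine_upto_scaleR
      affine_upto_mult affine_upto_inner
      affine_upto_const affine_upto_tangent_coeff affine_upto_cubic_error) auto
qed

lemma unif_O_Taylor:
  assumes "0 \<le> k" "k \<le> 4" "continuous_on {0..4} s" "\<And>\<theta>. \<theta> \<in> {0..4} \<Longrightarrow> 0 \<le> k + s \<theta> \<and> k + s \<theta> \<le> 4"
    and "n \<le> 5"
  shows "unif_O n (\<lambda>h \<theta>. \<gamma> ((k + s \<theta>) * h) - (\<Sum>m<n. h^m *\<^sub>R ((s \<theta>)^m *\<^sub>R taylor_coeff m (k * h))))"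
proof -
  obtain M where M: "\<And>x. x \<in> {0..T} \<Longrightarrow> norm (D n x) \<le> M" using bounded_D[OF assms(5)] by blast
  have "norm (D n 0) \<le> M" using M[of 0] T_pos by simp
  then have M0: "0 \<le> M" by (rule order_trans[OF norm_ge_zero])
  show ?thesis
  proof (rule unif_O_I[of _ "M * 4^n"])
    \<comment> \<open>The factor \<open>4^n\<close> bounds the power of the displacement: k and k +
      s both lie in [0, 4], so |s| \<le> 4.\<close>
    show "\<forall>\<^sub>F h in at_right 0. \<forall>\<theta>\<in>{0..4}.
       norm (\<gamma> ((k + s \<theta>) * h) - (\<Sum>m<n. h^m *\<^sub>R ((s \<theta>)^m *\<^sub>R taylor_coeff m (k * h)))) \<le> M * 4^n * h^n"
      using eventually_in_domain[of 4, simplified]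
    proof eventually_elim
      case (elim h)
      show ?case
      proof
        fix \<theta> :: real assume th: "\<theta> \<in> {0..4}"
        note b = assms(4)[OF th]
        have "4 * h \<le> T" using elim by simp
        moreover have "k * h \<le> 4 * h" "(k + s \<theta>) * h \<le> 4 * h"
          using b assms elim by (auto intro: mult_right_mono)
        ultimately have le: "k * h \<le> T" "(k + s \<theta>) * h \<le> T" by (auto intro: order_trans)
        then have x: "k * h \<in> {0..T}" and y: "(k + s \<theta>) * h \<in> {0..T}"
          using elim assms(1) b by auto
        have yx: "(k + s \<theta>) * h - k * h = s \<theta> * h" by (simp add: algebra_simps)
        have "norm (D 0 ((k + s \<theta>) * h) - (\<Sum>m<n. (((k + s \<theta>) * h - k * h)^m / fact m) *\<^sub>R D m (k * h)))
           \<le> M * \<bar>(k + s \<theta>) * h - k * h\<bar>^n"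
          using D_Suc M x y assms(5) by (intro vector_Taylor_bound[of "{0..T}"]) auto
        also have "\<dots> = M * (\<bar>s \<theta>\<bar>^n * h^n)" using elim by (simp add: yx abs_mult power_mult_distrib)
        also have "\<dots> \<le> M * (4^n * h^n)"
          using M0 elim b assms(1,2) by (intro mult_left_mono mult_right_mono power_mono) auto
        finally show "norm (\<gamma> ((k + s \<theta>) * h) - (\<Sum>m<n. h^m *\<^sub>R ((s \<theta>)^m *\<^sub>R taylor_coeff m (k * h)))) \<le> M * 4^n * h^n"
          unfolding yx D_0[OF y, symmetric] by (simp add: taylor_coeff_def power_mult_distrib mult_ac)
      qed
    qed
  qed
qed

lemma eventually_unit_curve:
  assumes "\<And>\<theta>. \<theta> \<in> {0..4} \<Longrightarrow> 0 \<le> s \<theta> \<and> s \<theta> \<le> 4"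
  shows "eventually_unit (\<lambda>h \<theta>. \<gamma> (s \<theta> * h))"
  unfolding eventually_unit_def using eventually_in_domain[of 4, simplified]
proof eventually_elim
  case (elim h)
  show ?case
  proof
    fix \<theta> :: real assume th: "\<theta> \<in> {0..4}"
    have "s \<theta> * h \<le> 4 * h" using assms[OF th] elim by (intro mult_right_mono) auto
    also have "4 * h \<le> T" using elim by simp
    finally show "norm (\<gamma> (s \<theta> * h)) = 1" using assms[OF th] elim by (intro norm_curve) auto
  qed
qed

lemma eventually_taylor_coeff_0:
  assumes "0 \<le> k"
  shows "\<forall>\<^sub>F h in at_right 0. taylor_coeff 0 (k * h) = \<gamma> (k * h)"
  using eventually_in_domain[OF assms] by eventually_elim (simp add: taylor_coeff_def D_0)

lemma eventually_unit_taylor_coeff_0: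
  assumes "0 \<le> k"
  shows "eventually_unit (\<lambda>h \<theta>. taylor_coeff 0 (k * h))"
  using eventually_in_domain[OF assms] eventually_taylor_coeff_0[OF assms] unfolding eventually_unit_def
  by eventually_elim (simp add: norm_curve)

lemma tangent_proj_taylor_coeff_0:
  assumes "0 \<le> k"
  shows "\<forall>\<^sub>F h in at_right 0. tangent_proj (k * h) (taylor_coeff 0 (k * h)) = 0"
  using eventually_unit_taylor_coeff_0[OF assms] unfolding eventually_unit_def
proof eventually_elim
  case (elim h)
  then have "norm (taylor_coeff 0 (k * h)) = 1" by force
  then show ?case by (simp add: tangent_proj_def dot_square_norm)
qed

lemma unif_O_Taylor_tangent_proj:
  assumes "0 \<le> k" "k \<le> 4" "continuous_on {0..4} s" "\<And>\<theta>. \<theta> \<in> {0..4} \<Longrightarrow> 0 \<le> k + s \<theta> \<and> k + s \<theta> \<le> 4"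
  shows "unif_O 5 (\<lambda>h \<theta>. tangent_proj (k * h) (\<gamma> ((k + s \<theta>) * h)) - (h *\<^sub>R (s \<theta> *\<^sub>R tangent_coeff 1 (k * h))
    + h^2 *\<^sub>R ((s \<theta>)^2 *\<^sub>R tangent_coeff 2 (k * h)) + h^3 *\<^sub>R ((s \<theta>)^3 *\<^sub>R tangent_coeff 3 (k * h)) + h^4 *\<^sub>R ((s \<theta>)^4 *\<^sub>R tangent_coeff 4 (k * h))))"
proof (rule unif_O_cong)
  show "unif_O 5 (\<lambda>h \<theta>. tangent_proj (k * h) (\<gamma> ((k + s \<theta>) * h) - (\<Sum>m<5. h^m *\<^sub>R ((s \<theta>)^m *\<^sub>R taylor_coeff m (k * h)))))"
    using assms by (intro unif_O_tangent_proj unif_O_Taylor) auto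
  have s: "{..<5} = {0, 1, 2, 3, 4::nat}" by auto
  show "\<forall>\<^sub>F h in at_right 0. \<forall>\<theta>\<in>{0..4}. tangent_proj (k * h) (\<gamma> ((k + s \<theta>) * h)) - (h *\<^sub>R (s \<theta> *\<^sub>R tangent_coeff 1 (k * h))
    + h^2 *\<^sub>R ((s \<theta>)^2 *\<^sub>R tangent_coeff 2 (k * h)) + h^3 *\<^sub>R ((s \<theta>)^3 *\<^sub>R tangent_coeff 3 (k * h)) + h^4 *\<^sub>R ((s \<theta>)^4 *\<^sub>R tangent_coeff 4 (k * h)))
    = tangent_proj (k * h) (\<gamma> ((k + s \<theta>) * h) - (\<Sum>m<5. h^m *\<^sub>R ((s \<theta>)^m *\<^sub>R taylor_coeff m (k * h))))"
    using tangent_proj_taylor_coeff_0[OF assms(1)]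
    by eventually_elim (simp add: s tangent_proj_simps tangent_coeff_def add.assoc)
qed

text \<open>Since \<open>norm u = norm v\<close>, the product of \<open>Q \<bullet> u - Q \<bullet> v\<close> and \<open>Q \<bullet> u + Q \<bullet> v\<close>, where
  \<open>Q = taylor_coeff 0 (k * h)\<close>, is minus the inner product of the tangential projections of
  \<open>u - v\<close> and \<open>u + v\<close>.\<close>

lemma normal_component_error:
  fixes u v :: "real \<Rightarrow> real \<Rightarrow> real^3" and w z :: "real \<Rightarrow> real \<Rightarrow> real^3"
  assumes "0 \<le> k" and u: "eventually_unit u" and v: "eventually_unit v"
    and du: "unif_O 1 (\<lambda>h \<theta>. u h \<theta> - taylor_coeff 0 (k * h))" and dv: "unif_O 1 (\<lambda>h \<theta>. v h \<theta> - taylor_coeff 0 (k * h))"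
    and w: "unif_O 0 w" and uv: "unif_O 4 (\<lambda>h \<theta>. tangent_proj (k * h) (u h \<theta> - v h \<theta>) - h^3 *\<^sub>R w h \<theta>)"
    and z: "unif_O 0 z"
    and pu: "unif_O 2 (\<lambda>h \<theta>. tangent_proj (k * h) (u h \<theta>) - h *\<^sub>R z h \<theta>)"
    and pv: "unif_O 2 (\<lambda>h \<theta>. tangent_proj (k * h) (v h \<theta>) - h *\<^sub>R z h \<theta>)"
  shows "unif_O 5 (\<lambda>h \<theta>. taylor_coeff 0 (k * h) \<bullet> (u h \<theta> - v h \<theta>) + h^4 * (w h \<theta> \<bullet> z h \<theta>))"
proof -
  define Q where "Q h = taylor_coeff 0 (k * h)" for h
  define n where "n h \<theta> = Q h \<bullet> (u h \<theta> - v h \<theta>)" for h \<theta>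
  define e where "e h \<theta> = (1 - Q h \<bullet> u h \<theta>) + (1 - Q h \<bullet> v h \<theta>)" for h \<theta>
  define d where "d h \<theta> = tangent_proj (k * h) (u h \<theta> - v h \<theta>)" for h \<theta>
  define s where "s h \<theta> = tangent_proj (k * h) (u h \<theta> + v h \<theta>)" for h \<theta>
  have Q: "eventually_unit (\<lambda>h \<theta>. Q h)" unfolding Q_def by (rule eventually_unit_taylor_coeff_0[OF assms(1)])
  have 1: "unif_O 2 (\<lambda>h \<theta>. 1 - Q h \<bullet> u h \<theta>)" "unif_O 2 (\<lambda>h \<theta>. 1 - Q h \<bullet> v h \<theta>)"
    unfolding Q_def
    using unif_O_one_minus_inner[OF eventually_unit_taylor_coeff_0[OF assms(1)] u du]
      unif_O_one_minus_inner[OF eventually_unit_taylor_coeff_0[OF assms(1)] v dv] by auto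
  have e: "unif_O 2 e" unfolding e_def using 1 by (intro unif_O_add)
  have "unif_O 2 (\<lambda>h \<theta>. (1 - Q h \<bullet> v h \<theta>) - (1 - Q h \<bullet> u h \<theta>))" using 1(2,1) by (rule unif_O_diff)
  then have n2: "unif_O 2 n" unfolding n_def by (simp add: inner_diff_right)
  have d4: "unif_O 4 (\<lambda>h \<theta>. d h \<theta> - h^3 *\<^sub>R w h \<theta>)" using uv unfolding d_def .
  have "unif_O 3 (\<lambda>h \<theta>. (d h \<theta> - h^3 *\<^sub>R w h \<theta>) + h^3 *\<^sub>R w h \<theta>)"
    by (intro unif_O_add unif_O_mono[OF d4] unif_O_pow_scaleR w) auto
  then have d3: "unif_O 3 d" by simp
  have "unif_O 2 (\<lambda>h \<theta>. (tangent_proj (k * h) (u h \<theta>) - h *\<^sub>R z h \<theta>) + (tangent_proj (k * h) (v h \<theta>) - h *\<^sub>R z h \<theta>))"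
    using pu pv by (rule unif_O_add)
  then have s2: "unif_O 2 (\<lambda>h \<theta>. s h \<theta> - h^1 *\<^sub>R (2 *\<^sub>R z h \<theta>))"
    unfolding s_def by (simp add: tangent_proj_simps scaleR_2 algebra_simps)
  have z2: "unif_O 0 (\<lambda>h \<theta>. 2 *\<^sub>R z h \<theta>)"
    by (intro unif_O_bounded_scaleR unif_O_const z)
  have "unif_O 1 (\<lambda>h \<theta>. (s h \<theta> - h^1 *\<^sub>R (2 *\<^sub>R z h \<theta>)) + h^1 *\<^sub>R (2 *\<^sub>R z h \<theta>))"
    by (intro unif_O_add unif_O_mono[OF s2] unif_O_pow_scaleR z2) auto
  then have s1: "unif_O 1 s" by simp
  \<comment> \<open>Equality of norms reads n (2 - e) = - d . s. Solved for n as here, it can be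
    iterated, since e is small.\<close>
  have key: "\<forall>\<^sub>F h in at_right 0. \<forall>\<theta>\<in>{0..4}. n h \<theta> = (1/2) * (e h \<theta> * n h \<theta>) - (1/2) * (d h \<theta> \<bullet> s h \<theta>)"
    using Q u v unfolding eventually_unit_def
  proof eventually_elim
    case (elim h)
    show ?case
    proof
      fix \<theta> :: real assume "\<theta> \<in> {0..4}"
      then have "norm (Q h) = 1" "norm (u h \<theta>) = 1" "norm (v h \<theta>) = 1"
        using elim by blast+
      then have dots: "Q h \<bullet> Q h = 1" "u h \<theta> \<bullet> u h \<theta> = 1" "v h \<theta> \<bullet> v h \<theta> = 1"
        by (simp_all add: dot_square_norm)
      have "d h \<theta> \<bullet> s h \<theta> = (v h \<theta> \<bullet> Q h)^2 - (u h \<theta> \<bullet> Q h)^2"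
        unfolding d_def s_def tangent_proj_def Q_def[symmetric]
        by (simp add: inner_diff_left inner_diff_right inner_add_left inner_add_right dots
            inner_commute power2_eq_square algebra_simps)
      also have "\<dots> = - n h \<theta> * (2 - e h \<theta>)"
        by (simp add: n_def e_def inner_diff_right inner_commute power2_eq_square algebra_simps)
      finally show "n h \<theta> = (1/2) * (e h \<theta> * n h \<theta>) - (1/2) * (d h \<theta> \<bullet> s h \<theta>)"
        by (simp add: algebra_simps)
    qed
  qed
  have ds: "unif_O 4 (\<lambda>h \<theta>. (1/2) * (d h \<theta> \<bullet> s h \<theta>))"
    by (intro unif_O_bounded_mult unif_O_const unif_O_inner[OF d3 s1]) simp
  \<comment> \<open>Bootstrap: n = O(h^2) gives e n = O(h^4) and therefore n = O(h^4); with this, e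
    n is O(h^6) and only d . s contributes at order four.\<close>
  have "unif_O 4 (\<lambda>h \<theta>. (1/2) * (e h \<theta> * n h \<theta>))"
    by (intro unif_O_bounded_mult unif_O_const unif_O_mult[OF e n2]) simp
  from unif_O_cong[OF unif_O_diff[OF this ds] key] have n4: "unif_O 4 n" .
  have "unif_O 5 (\<lambda>h \<theta>. (1/2) * (e h \<theta> * n h \<theta>) - ((1/2) * ((d h \<theta> - h^3 *\<^sub>R w h \<theta>) \<bullet> s h \<theta>)
      + (1/2) * ((h^3 *\<^sub>R w h \<theta>) \<bullet> (s h \<theta> - h^1 *\<^sub>R (2 *\<^sub>R z h \<theta>)))))"
    by (intro unif_O_add unif_O_diff unif_O_bounded_mult unif_O_const unif_O_mult[OF e n4]
        unif_O_inner[OF d4 s1] unif_O_inner[OF unif_O_pow_scaleR[OF w order_refl] s2]) auto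
  then have "unif_O 5 (\<lambda>h \<theta>. n h \<theta> + h^4 * (w h \<theta> \<bullet> z h \<theta>))"
  proof (rule unif_O_cong)
    show "\<forall>\<^sub>F h in at_right 0. \<forall>\<theta>\<in>{0..4}. n h \<theta> + h^4 * (w h \<theta> \<bullet> z h \<theta>) =
      (1/2) * (e h \<theta> * n h \<theta>) - ((1/2) * ((d h \<theta> - h^3 *\<^sub>R w h \<theta>) \<bullet> s h \<theta>)
      + (1/2) * ((h^3 *\<^sub>R w h \<theta>) \<bullet> (s h \<theta> - h^1 *\<^sub>R (2 *\<^sub>R z h \<theta>))))"
      using key
    proof eventually_elim
      case (elim h)
      show ?case
      proof
        fix \<theta> :: real assume "\<theta> \<in> {0..4}"
        with elim have k: "n h \<theta> = (1/2) * (e h \<theta> * n h \<theta>) - (1/2) * (d h \<theta> \<bullet> s h \<theta>)" by blast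
        show "n h \<theta> + h^4 * (w h \<theta> \<bullet> z h \<theta>) =
      (1/2) * (e h \<theta> * n h \<theta>) - ((1/2) * ((d h \<theta> - h^3 *\<^sub>R w h \<theta>) \<bullet> s h \<theta>)
      + (1/2) * ((h^3 *\<^sub>R w h \<theta>) \<bullet> (s h \<theta> - h^1 *\<^sub>R (2 *\<^sub>R z h \<theta>))))"
          by (subst k) (simp add: inner_diff_left inner_diff_right power3_eq_cube power4_eq_xxxx algebra_simps)
      qed
    qed
  qed
  then show ?thesis by (simp add: n_def Q_def)
qed

section \<open>Error expansion of a single SIDER2 stencil\<close>

text \<open>Modulo O(h^5), the end points \<open>L\<close> and \<open>R\<close> of the outer
  geodesic project to opposite vectors -W and W, so in projection the geodesic is symmetric about
  the middle node, and its point at \<tau> is \<mu> W plus the cubic slerp correction. As W itself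
  is affine in \<mu>, \<mu> W reproduces quadratic curves exactly.\<close>

lemma
  fixes i :: nat
  assumes i: "i \<le> 2"
  defines "k \<equiv> real i + 1"
  shows eventually_unit_sider2: "eventually_unit (\<lambda>h \<theta>. sider2 (\<lambda>j. \<gamma> (real j * h)) i \<theta>)"
    and sider2_error: "unif_O 5 (\<lambda>h \<theta>. sider2 (\<lambda>j. \<gamma> (real j * h)) i \<theta> - \<gamma> (\<theta> * h)
    - h^3 *\<^sub>R (((\<theta> - k) * (1 - (\<theta> - k)^2)) *\<^sub>R (cubic_error (k * h) + h *\<^sub>R ((\<theta> - k) *\<^sub>R quartic_error (k * h)))))"
proof -
  define Q where "Q = (\<lambda>h (\<theta>::real). taylor_coeff 0 (k * h))"
  define a1 where "a1 = (\<lambda>h (\<theta>::real). tangent_coeff 1 (k * h))"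
  define a2 where "a2 = (\<lambda>h (\<theta>::real). tangent_coeff 2 (k * h))"
  define a3 where "a3 = (\<lambda>h (\<theta>::real). tangent_coeff 3 (k * h))"
  define a4 where "a4 = (\<lambda>h (\<theta>::real). tangent_coeff 4 (k * h))"
  define p0 where "p0 = (\<lambda>h (\<theta>::real). \<gamma> (real i * h))"
  define p2 where "p2 = (\<lambda>h (\<theta>::real). \<gamma> (real (i + 2) * h))"
  define g where "g = (\<lambda>h \<theta>. \<gamma> (\<theta> * h))"
  define \<mu> where "\<mu> = (\<lambda>\<theta>. \<theta> - k)"
  define \<tau> where "\<tau> = (\<lambda>\<theta>. (\<theta> - real i) / 2)"
  define \<psi> where "\<psi> = (\<lambda>\<theta>. \<mu> \<theta> * (1 - (\<mu> \<theta>)^2))"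
  \<comment> \<open>The reflection formula stands in for slerp with parameter 2; the two agree once
    the points are close.\<close>
  define da where "da = (\<lambda>h \<theta>. (2 * (p2 h \<theta> \<bullet> Q h \<theta>)) *\<^sub>R Q h \<theta> - p2 h \<theta>)"
  define db where "db = (\<lambda>h \<theta>. (2 * (p0 h \<theta> \<bullet> Q h \<theta>)) *\<^sub>R Q h \<theta> - p0 h \<theta>)"
  define L where "L = (\<lambda>h \<theta>. slerp (p0 h \<theta>) (da h \<theta>) (\<tau> \<theta>))"
  define R where "R = (\<lambda>h \<theta>. slerp (db h \<theta>) (p2 h \<theta>) (\<tau> \<theta>))"
  define P where "P = (\<lambda>h \<theta>. slerp (L h \<theta>) (R h \<theta>) (\<tau> \<theta>))"
  define pj where "pj = (\<lambda>h. tangent_proj (k * h))"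
  have k: "0 \<le> k" "k \<le> 4" using i by (auto simp: k_def)
  \<comment> \<open>This is what the choice of the middle node as base point achieves: the centred
    parameter of the geodesics is also the Taylor displacement in units of h.\<close>
  have \<mu>\<tau>: "2 * \<tau> \<theta> - 1 = \<mu> \<theta>" for \<theta> by (simp add: \<tau>_def \<mu>_def k_def field_simps)
  have \<tau>: "-1 \<le> \<tau> \<theta> \<and> \<tau> \<theta> \<le> 2" if "\<theta> \<in> {0..4}" for \<theta> using that i by (auto simp: \<tau>_def)
  have cont[continuous_intros]: "continuous_on {0..4} \<mu>" "continuous_on {0..4} \<tau>" "continuous_on {0..4} \<psi>"
    unfolding \<psi>_def \<mu>_def \<tau>_def by (intro continuous_intros; simp)+
  have lin: "linear (pj h)" for h unfolding pj_def by (rule linear_tangent_proj)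
  have pj_O: "unif_O n (\<lambda>h \<theta>. pj h (f h \<theta>))" if "unif_O n f" for n f
    unfolding pj_def using that k(1) by (rule unif_O_tangent_proj)
  note pj_simps = linear_add[OF lin] linear_diff[OF lin] linear_cmul[OF lin]
  have pjQ: "\<forall>\<^sub>F h in at_right 0. \<forall>\<theta>\<in>{0..4}. pj h (Q h \<theta>) = 0"
    using tangent_proj_taylor_coeff_0[OF k(1)] by eventually_elim (simp add: pj_def Q_def)
  have a_O: "unif_O 0 a1" "unif_O 0 a2" "unif_O 0 a3" "unif_O 0 a4"
    unfolding a1_def a2_def a3_def a4_def using k by (auto intro: unif_O_tangent_coeff)

  have uQ: "eventually_unit Q" unfolding Q_def using k(1) by (rule eventually_unit_taylor_coeff_0)
  have u0: "eventually_unit p0" and u2: "eventually_unit p2" and ug: "eventually_unit g"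
    unfolding p0_def p2_def g_def using i by (intro eventually_unit_curve; simp)+
  have tay: "unif_O n (\<lambda>h \<theta>. \<gamma> (r \<theta> * h) - (\<Sum>m<n. h^m *\<^sub>R ((r \<theta> - k)^m *\<^sub>R taylor_coeff m (k * h))))"
    if "continuous_on {0..4} r" "\<And>\<theta>. \<theta> \<in> {0..4} \<Longrightarrow> 0 \<le> r \<theta> \<and> r \<theta> \<le> 4" "n \<le> 5" for r n
    using unif_O_Taylor[OF k continuous_on_diff[OF that(1) continuous_on_const], of k n] that(2,3) by simp
  have taypj: "unif_O 5 (\<lambda>h \<theta>. pj h (\<gamma> (r \<theta> * h)) - (h *\<^sub>R ((r \<theta> - k) *\<^sub>R a1 h \<theta>)
    + h^2 *\<^sub>R ((r \<theta> - k)^2 *\<^sub>R a2 h \<theta>) + h^3 *\<^sub>R ((r \<theta> - k)^3 *\<^sub>R a3 h \<theta>) + h^4 *\<^sub>R ((r \<theta> - k)^4 *\<^sub>R a4 h \<theta>)))"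
    if "continuous_on {0..4} r" "\<And>\<theta>. \<theta> \<in> {0..4} \<Longrightarrow> 0 \<le> r \<theta> \<and> r \<theta> \<le> 4" for r
    using unif_O_Taylor_tangent_proj[OF k continuous_on_diff[OF that(1) continuous_on_const], of k] that(2)
    by (simp add: a1_def a2_def a3_def a4_def pj_def)
  have d0: "unif_O 1 (\<lambda>h \<theta>. p0 h \<theta> - Q h \<theta>)"
    using tay[of "\<lambda>\<theta>. real i" 1] i by (simp add: p0_def Q_def)
  have d2: "unif_O 1 (\<lambda>h \<theta>. p2 h \<theta> - Q h \<theta>)"
    using tay[of "\<lambda>\<theta>. real (i + 2)" 1] i by (simp add: p2_def Q_def)
  have dg: "unif_O 1 (\<lambda>h \<theta>. g h \<theta> - Q h \<theta>)"
    using tay[of "\<lambda>\<theta>. \<theta>" 1] by (simp add: g_def Q_def)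
  have dd: "unif_O 2 (\<lambda>h \<theta>. p0 h \<theta> + p2 h \<theta> - 2 *\<^sub>R Q h \<theta>)"
  proof -
    have s: "{..<2} = {0, 1::nat}" by auto
    have "unif_O 2 (\<lambda>h \<theta>. p0 h \<theta> - (Q h \<theta> - h *\<^sub>R taylor_coeff 1 (k * h)))"
      using tay[of "\<lambda>\<theta>. real i" 2] i by (simp add: p0_def Q_def s k_def)
    moreover have "unif_O 2 (\<lambda>h \<theta>. p2 h \<theta> - (Q h \<theta> + h *\<^sub>R taylor_coeff 1 (k * h)))"
      using tay[of "\<lambda>\<theta>. real (i + 2)" 2] i by (simp add: p2_def Q_def s k_def)
    ultimately show ?thesis
      using unif_O_add[of 2 "\<lambda>h \<theta>. p0 h \<theta> - (Q h \<theta> - h *\<^sub>R taylor_coeff 1 (k * h))"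
          "\<lambda>h \<theta>. p2 h \<theta> - (Q h \<theta> + h *\<^sub>R taylor_coeff 1 (k * h))"]
      by (simp add: scaleR_2 algebra_simps)
  qed
  have c0: "unif_O 2 (\<lambda>h \<theta>. 1 - p0 h \<theta> \<bullet> Q h \<theta>)"
    using unif_O_one_minus_inner[OF uQ u0 d0, of 2] by (simp add: inner_commute)
  have c2: "unif_O 2 (\<lambda>h \<theta>. 1 - p2 h \<theta> \<bullet> Q h \<theta>)"
    using unif_O_one_minus_inner[OF uQ u2 d2, of 2] by (simp add: inner_commute)
  have e0: "unif_O 2 (\<lambda>h \<theta>. da h \<theta> - p0 h \<theta>)"
  proof -
    \<comment> \<open>The difference of \<open>da\<close> and \<open>p0\<close> is minus the second
      difference of the data, up to a multiple of the normal defect 1 - \<open>p2\<close> . Q. Both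
      are O(h^2), which makes the inner geodesics short.\<close>
    have "unif_O 2 (\<lambda>h \<theta>. - (p0 h \<theta> + p2 h \<theta> - 2 *\<^sub>R Q h \<theta>) - (2 * (1 - p2 h \<theta> \<bullet> Q h \<theta>)) *\<^sub>R Q h \<theta>)"
      by (intro unif_O_diff unif_O_minus dd unif_O_scaleR[OF _ eventually_unit_unif_O[OF uQ], of 2]
          unif_O_bounded_mult unif_O_const c2) auto
    then show ?thesis by (simp add: da_def scaleR_2 algebra_simps)
  qed
  have e2: "unif_O 2 (\<lambda>h \<theta>. p2 h \<theta> - db h \<theta>)"
  proof -
    have "unif_O 2 (\<lambda>h \<theta>. (p0 h \<theta> + p2 h \<theta> - 2 *\<^sub>R Q h \<theta>) + (2 * (1 - p0 h \<theta> \<bullet> Q h \<theta>)) *\<^sub>R Q h \<theta>)"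
      by (intro unif_O_add dd unif_O_scaleR[OF _ eventually_unit_unif_O[OF uQ], of 2]
          unif_O_bounded_mult unif_O_const c0) auto
    then show ?thesis by (simp add: db_def scaleR_2 algebra_simps)
  qed

  have slerp_a: "\<forall>\<^sub>F h in at_right 0. \<forall>\<theta>\<in>{0..4}. slerp (p2 h \<theta>) (Q h \<theta>) 2 = da h \<theta> \<and> norm (da h \<theta>) = 1"
    using uQ u2 unif_O_eventually_le[OF d2 zero_less_one zero_less_one] unfolding eventually_unit_def
  proof eventually_elim
    case (elim h)
    then show ?case
      using slerp_2[of "p2 h _" "Q h _"] norm_slerp[of "p2 h _" "Q h _" 2]
        unit_close_not_antipodal[of "p2 h _" "Q h _"]
      by (simp add: da_def norm_minus_commute)
  qed
  have slerp_b: "\<forall>\<^sub>F h in at_right 0. \<forall>\<theta>\<in>{0..4}. slerp (p0 h \<theta>) (Q h \<theta>) 2 = db h \<theta> \<and> norm (db h \<theta>) = 1"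
    using uQ u0 unif_O_eventually_le[OF d0 zero_less_one zero_less_one] unfolding eventually_unit_def
  proof eventually_elim
    case (elim h)
    then show ?case
      using slerp_2[of "p0 h _" "Q h _"] norm_slerp[of "p0 h _" "Q h _" 2]
        unit_close_not_antipodal[of "p0 h _" "Q h _"]
      by (simp add: db_def norm_minus_commute)
  qed
  have ua: "eventually_unit da" and ub: "eventually_unit db"
    using slerp_a slerp_b unfolding eventually_unit_def by (auto elim: eventually_mono)
  have sider: "\<forall>\<^sub>F h in at_right 0. \<forall>\<theta>\<in>{0..4}. sider2 (\<lambda>j. \<gamma> (real j * h)) i \<theta> = P h \<theta>"
    using slerp_a slerp_b eventually_taylor_coeff_0[OF k(1)]
  proof eventually_elim
    case (elim h)
    have "\<gamma> ((1 + real i) * h) = Q h \<theta>" for \<theta>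
      using elim by (simp add: Q_def k_def add.commute)
    then show ?case using elim
      by (simp add: sider2_def sider_left_def sider_right_def sider_da_def sider_db_def
          P_def L_def R_def \<tau>_def p0_def p2_def)
  qed

  \<comment> \<open>Tangential parts of the inner geodesics\<close>
  define v0 where "v0 = (\<lambda>h \<theta>. pj h (p0 h \<theta>))"
  define v2 where "v2 = (\<lambda>h \<theta>. pj h (p2 h \<theta>))"
  \<comment> \<open>Chord interpolation between -\<open>v0\<close> and \<open>v2\<close>, the
    projections of the end points of the right inner geodesic. The left one runs between the
    opposite vectors and yields -W.\<close>
  define W where "W = (\<lambda>h \<theta>. (1/2) *\<^sub>R (v2 h \<theta> - v0 h \<theta>) + (\<mu> \<theta> / 2) *\<^sub>R (v2 h \<theta> + v0 h \<theta>))"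
  have pjd: "\<forall>\<^sub>F h in at_right 0. \<forall>\<theta>\<in>{0..4}. pj h (da h \<theta>) = - v2 h \<theta> \<and> pj h (db h \<theta>) = - v0 h \<theta>"
    using pjQ by eventually_elim (simp add: da_def db_def pj_simps v0_def v2_def)
  have v0: "unif_O 1 v0"
  proof (rule unif_O_cong[OF pj_O[OF d0]])
    show "\<forall>\<^sub>F h in at_right 0. \<forall>\<theta>\<in>{0..4}. v0 h \<theta> = pj h (p0 h \<theta> - Q h \<theta>)"
      using pjQ by eventually_elim (simp add: pj_simps v0_def)
  qed
  have v2: "unif_O 1 v2"
  proof (rule unif_O_cong[OF pj_O[OF d2]])
    show "\<forall>\<^sub>F h in at_right 0. \<forall>\<theta>\<in>{0..4}. v2 h \<theta> = pj h (p2 h \<theta> - Q h \<theta>)"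
      using pjQ by eventually_elim (simp add: pj_simps v2_def)
  qed
  have cmu: "continuous_on {0..4} (\<lambda>\<theta>. \<mu> \<theta> / 2)" "continuous_on {0..4} (\<lambda>\<theta>. \<mu> \<theta> * (1 - (\<mu> \<theta>)\<^sup>2) / 24)"
    by (intro continuous_intros; simp)+
  \<comment> \<open>Order count: chord O(h^2) and projected midpoint O(h) give 2 * 2 + 1 = 5. The
    cubic slerp term is squared chord times half chord, hence O(h^6), and is dropped.\<close>
  have inner_step: "unif_O 5 (\<lambda>h \<theta>. pj h (slerp (x h \<theta>) (y h \<theta>) (\<tau> \<theta>))
      - pj h ((x h \<theta> + y h \<theta>) /\<^sub>R 2) - \<mu> \<theta> *\<^sub>R pj h ((y h \<theta> - x h \<theta>) /\<^sub>R 2))"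
    if ux: "eventually_unit x" and uy: "eventually_unit y" and xy: "unif_O 2 (\<lambda>h \<theta>. y h \<theta> - x h \<theta>)"
      and S: "unif_O 1 (\<lambda>h \<theta>. pj h ((x h \<theta> + y h \<theta>) /\<^sub>R 2))"
    for x y :: "real \<Rightarrow> real \<Rightarrow> real^3"
  proof -
    have D: "unif_O 2 (\<lambda>h \<theta>. pj h ((y h \<theta> - x h \<theta>) /\<^sub>R 2))"
      by (intro pj_O unif_O_bounded_scaleR unif_O_const xy)
    have 1: "unif_O 5 (\<lambda>h \<theta>. pj h (slerp (x h \<theta>) (y h \<theta>) (\<tau> \<theta>)) - pj h ((x h \<theta> + y h \<theta>) /\<^sub>R 2)
        - (\<mu> \<theta> + \<mu> \<theta> * (1 - (\<mu> \<theta>)^2) / 24 * norm (y h \<theta> - x h \<theta>)^2) *\<^sub>R pj h ((y h \<theta> - x h \<theta>) /\<^sub>R 2))"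
      using unif_O_slerp_linear[where f=pj and k=5, OF ux uy xy _ \<tau> lin S D] unfolding \<mu>\<tau> by simp
    have "unif_O 5 (\<lambda>h \<theta>. (\<mu> \<theta> * (1 - (\<mu> \<theta>)^2) / 24 * (norm (y h \<theta> - x h \<theta>) * norm (y h \<theta> - x h \<theta>)))
        *\<^sub>R pj h ((y h \<theta> - x h \<theta>) /\<^sub>R 2))"
      by (intro unif_O_scaleR[OF _ D, of 4] unif_O_bounded_mult unif_O_theta cmu
          unif_O_mult[OF unif_O_norm[OF xy] unif_O_norm[OF xy]]) auto
    from unif_O_add[OF 1 this] show ?thesis
      by (rule unif_O_cong) (simp add: power2_eq_square algebra_simps)
  qed
  have half: "(x::real^3) /\<^sub>R 2 = (1/2) *\<^sub>R x" for x by simp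
  have S_L: "\<forall>\<^sub>F h in at_right 0. \<forall>\<theta>\<in>{0..4}. pj h ((p0 h \<theta> + da h \<theta>) /\<^sub>R 2) = (1/2) *\<^sub>R (v0 h \<theta> - v2 h \<theta>)
      \<and> pj h ((da h \<theta> - p0 h \<theta>) /\<^sub>R 2) = (1/2) *\<^sub>R (- v2 h \<theta> - v0 h \<theta>)"
    using pjd by eventually_elim (simp add: half pj_simps v0_def)
  have S_R: "\<forall>\<^sub>F h in at_right 0. \<forall>\<theta>\<in>{0..4}. pj h ((db h \<theta> + p2 h \<theta>) /\<^sub>R 2) = (1/2) *\<^sub>R (v2 h \<theta> - v0 h \<theta>)
      \<and> pj h ((p2 h \<theta> - db h \<theta>) /\<^sub>R 2) = (1/2) *\<^sub>R (v2 h \<theta> + v0 h \<theta>)"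
    using pjd by eventually_elim (simp add: half pj_simps v2_def)
  have PL: "unif_O 5 (\<lambda>h \<theta>. pj h (L h \<theta>) + W h \<theta>)"
  proof -
    have "unif_O 1 (\<lambda>h \<theta>. (1/2) *\<^sub>R (v0 h \<theta> - v2 h \<theta>))"
      by (intro unif_O_bounded_scaleR unif_O_const unif_O_diff v0 v2)
    then have "unif_O 1 (\<lambda>h \<theta>. pj h ((p0 h \<theta> + da h \<theta>) /\<^sub>R 2))"
      by (rule unif_O_cong) (use S_L in \<open>auto elim: eventually_mono\<close>)
    from inner_step[OF u0 ua e0 this] show ?thesis
    proof (rule unif_O_cong)
      show "\<forall>\<^sub>F h in at_right 0. \<forall>\<theta>\<in>{0..4}. pj h (L h \<theta>) + W h \<theta> = pj h (slerp (p0 h \<theta>) (da h \<theta>) (\<tau> \<theta>))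
      - pj h ((p0 h \<theta> + da h \<theta>) /\<^sub>R 2) - \<mu> \<theta> *\<^sub>R pj h ((da h \<theta> - p0 h \<theta>) /\<^sub>R 2)"
        using S_L
      proof eventually_elim
        case (elim h)
        show ?case
        proof
          fix \<theta> :: real assume "\<theta> \<in> {0..4}"
          then have e: "pj h ((p0 h \<theta> + da h \<theta>) /\<^sub>R 2) = (1/2) *\<^sub>R (v0 h \<theta> - v2 h \<theta>)"
              "pj h ((da h \<theta> - p0 h \<theta>) /\<^sub>R 2) = (1/2) *\<^sub>R (- v2 h \<theta> - v0 h \<theta>)"
            using elim by blast+
          show "pj h (L h \<theta>) + W h \<theta> = pj h (slerp (p0 h \<theta>) (da h \<theta>) (\<tau> \<theta>))
            - pj h ((p0 h \<theta> + da h \<theta>) /\<^sub>R 2) - \<mu> \<theta> *\<^sub>R pj h ((da h \<theta> - p0 h \<theta>) /\<^sub>R 2)"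
            unfolding e by (simp add: L_def W_def vec_eq_iff field_simps)
        qed
      qed
    qed
  qed
  have PR: "unif_O 5 (\<lambda>h \<theta>. pj h (R h \<theta>) - W h \<theta>)"
  proof -
    have "unif_O 1 (\<lambda>h \<theta>. (1/2) *\<^sub>R (v2 h \<theta> - v0 h \<theta>))"
      by (intro unif_O_bounded_scaleR unif_O_const unif_O_diff v0 v2)
    then have "unif_O 1 (\<lambda>h \<theta>. pj h ((db h \<theta> + p2 h \<theta>) /\<^sub>R 2))"
      by (rule unif_O_cong) (use S_R in \<open>auto elim: eventually_mono\<close>)
    from inner_step[OF ub u2 e2 this] show ?thesis
    proof (rule unif_O_cong)
      show "\<forall>\<^sub>F h in at_right 0. \<forall>\<theta>\<in>{0..4}. pj h (R h \<theta>) - W h \<theta> = pj h (slerp (db h \<theta>) (p2 h \<theta>) (\<tau> \<theta>))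
      - pj h ((db h \<theta> + p2 h \<theta>) /\<^sub>R 2) - \<mu> \<theta> *\<^sub>R pj h ((p2 h \<theta> - db h \<theta>) /\<^sub>R 2)"
        using S_R
      proof eventually_elim
        case (elim h)
        show ?case
        proof
          fix \<theta> :: real assume "\<theta> \<in> {0..4}"
          then have e: "pj h ((db h \<theta> + p2 h \<theta>) /\<^sub>R 2) = (1/2) *\<^sub>R (v2 h \<theta> - v0 h \<theta>)"
              "pj h ((p2 h \<theta> - db h \<theta>) /\<^sub>R 2) = (1/2) *\<^sub>R (v2 h \<theta> + v0 h \<theta>)"
            using elim by blast+
          show "pj h (R h \<theta>) - W h \<theta> = pj h (slerp (db h \<theta>) (p2 h \<theta>) (\<tau> \<theta>))
            - pj h ((db h \<theta> + p2 h \<theta>) /\<^sub>R 2) - \<mu> \<theta> *\<^sub>R pj h ((p2 h \<theta> - db h \<theta>) /\<^sub>R 2)"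
            unfolding e by (simp add: R_def W_def vec_eq_iff field_simps)
        qed
      qed
    qed
  qed

  \<comment> \<open>Norms and distances for the outer geodesic\<close>
  have uL: "eventually_unit L" unfolding L_def by (rule eventually_unit_slerp[OF u0 ua e0]) simp
  have uR: "eventually_unit R" unfolding R_def by (rule eventually_unit_slerp[OF ub u2 e2]) simp
  have near: "unif_O 2 (\<lambda>h \<theta>. slerp (x h \<theta>) (y h \<theta>) (\<tau> \<theta>) - x h \<theta> - \<tau> \<theta> *\<^sub>R (y h \<theta> - x h \<theta>))"
    if "eventually_unit x" "eventually_unit y" "unif_O n (\<lambda>h \<theta>. y h \<theta> - x h \<theta>)" "1 \<le> n" for x y n
    using unif_O_slerp_affine[where k=2, OF that(1-3) _ \<tau>] that(4) by (simp add: algebra_simps)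
  have LQ: "unif_O 1 (\<lambda>h \<theta>. L h \<theta> - Q h \<theta>)"
  proof -
    have "unif_O 1 (\<lambda>h \<theta>. (slerp (p0 h \<theta>) (da h \<theta>) (\<tau> \<theta>) - p0 h \<theta> - \<tau> \<theta> *\<^sub>R (da h \<theta> - p0 h \<theta>))
        + (\<tau> \<theta> *\<^sub>R (da h \<theta> - p0 h \<theta>) + (p0 h \<theta> - Q h \<theta>)))"
      by (intro unif_O_add unif_O_mono[OF near[OF u0 ua e0]] unif_O_theta_scaleR cont
          unif_O_mono[OF e0] d0) auto
    then show ?thesis by (simp add: L_def)
  qed
  have RQ: "unif_O 1 (\<lambda>h \<theta>. R h \<theta> - Q h \<theta>)"
  proof -
    have "unif_O 1 (\<lambda>h \<theta>. (slerp (db h \<theta>) (p2 h \<theta>) (\<tau> \<theta>) - db h \<theta> - \<tau> \<theta> *\<^sub>R (p2 h \<theta> - db h \<theta>))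
        + (\<tau> \<theta> *\<^sub>R (p2 h \<theta> - db h \<theta>) + (- (p2 h \<theta> - db h \<theta>) + (p2 h \<theta> - Q h \<theta>))))"
      by (intro unif_O_add unif_O_minus unif_O_mono[OF near[OF ub u2 e2]] unif_O_theta_scaleR cont
          unif_O_mono[OF e2] d2) auto
    then show ?thesis by (simp add: R_def)
  qed
  have RL: "unif_O 1 (\<lambda>h \<theta>. R h \<theta> - L h \<theta>)"
    using unif_O_diff[OF RQ LQ] by simp
  have uP: "eventually_unit P" unfolding P_def by (rule eventually_unit_slerp[OF uL uR RL]) simp
  show "eventually_unit (\<lambda>h \<theta>. sider2 (\<lambda>j. \<gamma> (real j * h)) i \<theta>)"
    using uP sider unfolding eventually_unit_def by eventually_elim simp
  have PQ: "unif_O 1 (\<lambda>h \<theta>. P h \<theta> - Q h \<theta>)"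
  proof -
    have "unif_O 1 (\<lambda>h \<theta>. (slerp (L h \<theta>) (R h \<theta>) (\<tau> \<theta>) - L h \<theta> - \<tau> \<theta> *\<^sub>R (R h \<theta> - L h \<theta>))
        + (\<tau> \<theta> *\<^sub>R (R h \<theta> - L h \<theta>) + (L h \<theta> - Q h \<theta>)))"
      by (intro unif_O_add unif_O_mono[OF near[OF uL uR RL]] unif_O_theta_scaleR cont
          RL LQ) auto
    then show ?thesis by (simp add: P_def)
  qed

  \<comment> \<open>Tangential part of the outer geodesic\<close>
  define V where "V = (\<lambda>h \<theta>. h *\<^sub>R a1 h \<theta> + h^3 *\<^sub>R a3 h \<theta> + \<mu> \<theta> *\<^sub>R (h^2 *\<^sub>R a2 h \<theta> + h^4 *\<^sub>R a4 h \<theta>))"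
  \<comment> \<open>The nodes lie at displacements -1 and 1, so half the difference of
    \<open>v2\<close> and \<open>v0\<close> is the odd part of the Taylor polynomial and half their
    sum the even part.\<close>
  have WV: "unif_O 5 (\<lambda>h \<theta>. W h \<theta> - V h \<theta>)"
  proof -
    have t0: "unif_O 5 (\<lambda>h \<theta>. v0 h \<theta> - (- (h *\<^sub>R a1 h \<theta>) + h^2 *\<^sub>R a2 h \<theta> - h^3 *\<^sub>R a3 h \<theta> + h^4 *\<^sub>R a4 h \<theta>))"
      using taypj[of "\<lambda>\<theta>. real i"] i by (simp add: v0_def p0_def k_def)
    have t2: "unif_O 5 (\<lambda>h \<theta>. v2 h \<theta> - (h *\<^sub>R a1 h \<theta> + h^2 *\<^sub>R a2 h \<theta> + h^3 *\<^sub>R a3 h \<theta> + h^4 *\<^sub>R a4 h \<theta>))"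
      using taypj[of "\<lambda>\<theta>. real (i + 2)"] i by (simp add: v2_def p2_def k_def)
    have "unif_O 5 (\<lambda>h \<theta>. (1/2 + \<mu> \<theta> / 2) *\<^sub>R (v2 h \<theta> - (h *\<^sub>R a1 h \<theta> + h^2 *\<^sub>R a2 h \<theta> + h^3 *\<^sub>R a3 h \<theta> + h^4 *\<^sub>R a4 h \<theta>))
        + (\<mu> \<theta> / 2 - 1/2) *\<^sub>R (v0 h \<theta> - (- (h *\<^sub>R a1 h \<theta>) + h^2 *\<^sub>R a2 h \<theta> - h^3 *\<^sub>R a3 h \<theta> + h^4 *\<^sub>R a4 h \<theta>)))"
      by (intro unif_O_add unif_O_theta_scaleR t0 t2 continuous_intros) auto
    then show ?thesis
      by (rule unif_O_cong) (simp add: W_def V_def vec_eq_iff field_simps)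
  qed
  note bdd = unif_O_bounded_scaleR unif_O_bounded_mult unif_O_bounded_inner unif_O_theta unif_O_const a_O
  \<comment> \<open>Nested remainders, V = h a1 + h^2 r1 and r1 = \<mu> a2 + h r2, from which |V|^2
    can be read off through order h^3.\<close>
  define r2 where "r2 = (\<lambda>h \<theta>. a3 h \<theta> + h^1 *\<^sub>R (\<mu> \<theta> *\<^sub>R a4 h \<theta>))"
  define r1 where "r1 = (\<lambda>h \<theta>. \<mu> \<theta> *\<^sub>R a2 h \<theta> + h^1 *\<^sub>R r2 h \<theta>)"
  have r2: "unif_O 0 r2" unfolding r2_def by (intro unif_O_add unif_O_pow_scaleR bdd cont) auto
  have r1: "unif_O 0 r1" unfolding r1_def by (intro unif_O_add unif_O_pow_scaleR bdd cont r2) auto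
  have V_r1: "V h \<theta> = h^1 *\<^sub>R a1 h \<theta> + h^2 *\<^sub>R r1 h \<theta>" for h \<theta>
    by (simp add: V_def r1_def r2_def vec_eq_iff power2_eq_square power3_eq_cube power4_eq_xxxx algebra_simps)
  have V: "unif_O 1 V"
  proof -
    have "unif_O 1 (\<lambda>h \<theta>. h^1 *\<^sub>R a1 h \<theta> + h^2 *\<^sub>R r1 h \<theta>)"
      by (intro unif_O_add unif_O_pow_scaleR a_O r1) auto
    then show ?thesis by (simp only: V_r1[symmetric])
  qed
  \<comment> \<open>The part of |V|^2 through h^3. It is going to be multiplied by V = O(h), so an
    error O(h^4) is allowed.\<close>
  define N where "N = (\<lambda>h \<theta>. h^2 * (a1 h \<theta> \<bullet> a1 h \<theta>) + h^3 * (2 * (\<mu> \<theta> * (a1 h \<theta> \<bullet> a2 h \<theta>))))"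
  have N: "unif_O 2 N"
    unfolding N_def by (intro unif_O_add unif_O_pow_mult bdd cont) auto
  have VN: "unif_O 4 (\<lambda>h \<theta>. V h \<theta> \<bullet> V h \<theta> - N h \<theta>)"
  proof -
    have "unif_O 4 (\<lambda>h \<theta>. h^4 * (2 * (a1 h \<theta> \<bullet> r2 h \<theta>) + r1 h \<theta> \<bullet> r1 h \<theta>))"
      by (intro unif_O_pow_mult unif_O_add bdd r1 r2) auto
    then show ?thesis
    proof (rule unif_O_cong)
      have "V h \<theta> \<bullet> V h \<theta> - N h \<theta> = h^4 * (2 * (a1 h \<theta> \<bullet> r2 h \<theta>) + r1 h \<theta> \<bullet> r1 h \<theta>)" for h \<theta>
      proof -
        have "a1 h \<theta> \<bullet> r1 h \<theta> = \<mu> \<theta> * (a1 h \<theta> \<bullet> a2 h \<theta>) + h * (a1 h \<theta> \<bullet> r2 h \<theta>)"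
          by (simp add: r1_def inner_add_right)
        then show ?thesis
          unfolding V_r1 by (simp add: N_def inner_add_left inner_add_right inner_commute
            power2_eq_square power3_eq_cube power4_eq_xxxx algebra_simps)
      qed
      then show "\<forall>\<^sub>F h in at_right 0. \<forall>\<theta>\<in>{0..4}. V h \<theta> \<bullet> V h \<theta> - N h \<theta>
          = h^4 * (2 * (a1 h \<theta> \<bullet> r2 h \<theta>) + r1 h \<theta> \<bullet> r1 h \<theta>)" by simp
    qed
  qed
  define E where "E = (\<lambda>h \<theta>. pj h (R h \<theta> - L h \<theta>) - 2 *\<^sub>R V h \<theta>)"
  have E: "unif_O 5 E"
  proof -
    have "unif_O 5 (\<lambda>h \<theta>. (pj h (R h \<theta>) - W h \<theta>) - (pj h (L h \<theta>) + W h \<theta>) + 2 *\<^sub>R (W h \<theta> - V h \<theta>))"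
      by (intro unif_O_add unif_O_diff PL PR unif_O_bounded_scaleR unif_O_const WV)
    then show ?thesis
      by (rule unif_O_cong) (simp add: E_def pj_simps scaleR_2 algebra_simps)
  qed
  have RL2: "unif_O 4 (\<lambda>h \<theta>. norm (R h \<theta> - L h \<theta>)^2 - 4 * N h \<theta>)"
  proof -
    \<comment> \<open>By Pythagoras the squared chord is the squared projection plus the squared
      normal part. The normal part is a difference of two defects O(h^2), so its square is
      O(h^4).\<close>
    have QL: "unif_O 2 (\<lambda>h \<theta>. 1 - Q h \<theta> \<bullet> L h \<theta>)" and QR: "unif_O 2 (\<lambda>h \<theta>. 1 - Q h \<theta> \<bullet> R h \<theta>)"
      using unif_O_one_minus_inner[OF uQ uL LQ] unif_O_one_minus_inner[OF uQ uR RQ] by auto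
    have Qw: "unif_O 2 (\<lambda>h \<theta>. Q h \<theta> \<bullet> (R h \<theta> - L h \<theta>))"
      using unif_O_diff[OF QL QR] by (simp add: inner_diff_right)
    have "unif_O 4 (\<lambda>h \<theta>. 4 * (V h \<theta> \<bullet> V h \<theta> - N h \<theta>) + (4 * (V h \<theta> \<bullet> E h \<theta>)
       + (E h \<theta> \<bullet> E h \<theta> + (Q h \<theta> \<bullet> (R h \<theta> - L h \<theta>)) * (Q h \<theta> \<bullet> (R h \<theta> - L h \<theta>)))))"
      by (intro unif_O_add unif_O_bounded_mult unif_O_const VN unif_O_inner[OF V E] unif_O_inner[OF E E]
          unif_O_mult[OF Qw Qw]) auto
    then show ?thesis
    proof (rule unif_O_cong)
      show "\<forall>\<^sub>F h in at_right 0. \<forall>\<theta>\<in>{0..4}. norm (R h \<theta> - L h \<theta>)^2 - 4 * N h \<theta>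
        = 4 * (V h \<theta> \<bullet> V h \<theta> - N h \<theta>) + (4 * (V h \<theta> \<bullet> E h \<theta>)
       + (E h \<theta> \<bullet> E h \<theta> + (Q h \<theta> \<bullet> (R h \<theta> - L h \<theta>)) * (Q h \<theta> \<bullet> (R h \<theta> - L h \<theta>))))"
        using uQ unfolding eventually_unit_def
      proof eventually_elim
        case (elim h)
        show ?case
        proof
          fix \<theta> :: real assume "\<theta> \<in> {0..4}"
          then have QQ: "Q h \<theta> \<bullet> Q h \<theta> = 1" using elim by (simp add: dot_square_norm)
          define w where "w = R h \<theta> - L h \<theta>"
          have pw: "pj h w = w - (Q h \<theta> \<bullet> w) *\<^sub>R Q h \<theta>"
            by (simp add: pj_def tangent_proj_def Q_def)
          have "pj h w \<bullet> pj h w + (Q h \<theta> \<bullet> w) * (Q h \<theta> \<bullet> w) = w \<bullet> w"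
            unfolding pw by (simp add: inner_diff_left inner_diff_right QQ inner_commute algebra_simps)
          moreover have "pj h w = 2 *\<^sub>R V h \<theta> + E h \<theta>" by (simp add: E_def w_def)
          ultimately show "norm (R h \<theta> - L h \<theta>)^2 - 4 * N h \<theta>
            = 4 * (V h \<theta> \<bullet> V h \<theta> - N h \<theta>) + (4 * (V h \<theta> \<bullet> E h \<theta>)
           + (E h \<theta> \<bullet> E h \<theta> + (Q h \<theta> \<bullet> (R h \<theta> - L h \<theta>)) * (Q h \<theta> \<bullet> (R h \<theta> - L h \<theta>))))"
            unfolding w_def[symmetric] power2_norm_eq_inner
            by (simp add: inner_add_left inner_add_right inner_commute algebra_simps)
        qed
      qed
    qed
  qed
  have PP: "unif_O 5 (\<lambda>h \<theta>. pj h (P h \<theta>) - (\<mu> \<theta> + \<psi> \<theta> / 6 * N h \<theta>) *\<^sub>R V h \<theta>)"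
  proof -
    have S: "unif_O 5 (\<lambda>h \<theta>. pj h ((L h \<theta> + R h \<theta>) /\<^sub>R 2))"
    proof -
      have "unif_O 5 (\<lambda>h \<theta>. (1/2) *\<^sub>R ((pj h (L h \<theta>) + W h \<theta>) + (pj h (R h \<theta>) - W h \<theta>)))"
        by (intro unif_O_bounded_scaleR unif_O_const unif_O_add PL PR)
      then show ?thesis by (rule unif_O_cong) (simp add: half pj_simps)
    qed
    have D: "unif_O 1 (\<lambda>h \<theta>. pj h ((R h \<theta> - L h \<theta>) /\<^sub>R 2))"
      by (intro pj_O unif_O_bounded_scaleR unif_O_const RL)
    \<comment> \<open>The order count is tight here: chord and half chord are O(h), so the remainder
      has order 4 * 1 + 1 = 5. The cubic slerp term is O(h^3) and must be kept.\<close>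
    have X: "unif_O 5 (\<lambda>h \<theta>. pj h (P h \<theta>) - pj h ((L h \<theta> + R h \<theta>) /\<^sub>R 2)
        - (\<mu> \<theta> + \<mu> \<theta> * (1 - (\<mu> \<theta>)^2) / 24 * norm (R h \<theta> - L h \<theta>)^2) *\<^sub>R pj h ((R h \<theta> - L h \<theta>) /\<^sub>R 2))"
      using unif_O_slerp_linear[where f=pj and k=5, OF uL uR RL _ \<tau> lin S D] unfolding \<mu>\<tau> P_def by simp
    have "unif_O 5 (\<lambda>h \<theta>. (pj h (P h \<theta>) - pj h ((L h \<theta> + R h \<theta>) /\<^sub>R 2)
        - (\<mu> \<theta> + \<mu> \<theta> * (1 - (\<mu> \<theta>)^2) / 24 * norm (R h \<theta> - L h \<theta>)^2) *\<^sub>R pj h ((R h \<theta> - L h \<theta>) /\<^sub>R 2))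
        + pj h ((L h \<theta> + R h \<theta>) /\<^sub>R 2)
        + (\<psi> \<theta> / 24 * (norm (R h \<theta> - L h \<theta>)^2 - 4 * N h \<theta>)) *\<^sub>R pj h ((R h \<theta> - L h \<theta>) /\<^sub>R 2)
        + (\<mu> \<theta> + \<psi> \<theta> / 6 * N h \<theta>) *\<^sub>R ((1/2) *\<^sub>R E h \<theta>))"
      by (intro unif_O_add X S unif_O_scaleR[OF unif_O_bounded_mult[OF unif_O_theta RL2] D]
          unif_O_bounded_scaleR[OF _ E] unif_O_bounded_scaleR bdd unif_O_mono[OF N] cont continuous_intros) auto
    then show ?thesis
    proof (rule unif_O_cong)
      have id: "x - (m + p / 6 * n) *\<^sub>R v = (x - s - (m + p / 24 * t) *\<^sub>R d) + s
          + (p / 24 * (t - 4 * n)) *\<^sub>R d + (m + p / 6 * n) *\<^sub>R (d - v)"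
        for x v s d :: "real^3" and m n p t :: real
        by (simp add: vec_eq_iff field_simps)
      have dv: "(1/2) *\<^sub>R E h \<theta> = pj h ((R h \<theta> - L h \<theta>) /\<^sub>R 2) - V h \<theta>" for h \<theta>
        by (simp add: E_def half pj_simps vec_eq_iff field_simps)
      show "\<forall>\<^sub>F h in at_right 0. \<forall>\<theta>\<in>{0..4}. pj h (P h \<theta>) - (\<mu> \<theta> + \<psi> \<theta> / 6 * N h \<theta>) *\<^sub>R V h \<theta> =
        (pj h (P h \<theta>) - pj h ((L h \<theta> + R h \<theta>) /\<^sub>R 2)
        - (\<mu> \<theta> + \<mu> \<theta> * (1 - (\<mu> \<theta>)^2) / 24 * norm (R h \<theta> - L h \<theta>)^2) *\<^sub>R pj h ((R h \<theta> - L h \<theta>) /\<^sub>R 2))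
        + pj h ((L h \<theta> + R h \<theta>) /\<^sub>R 2)
        + (\<psi> \<theta> / 24 * (norm (R h \<theta> - L h \<theta>)^2 - 4 * N h \<theta>)) *\<^sub>R pj h ((R h \<theta> - L h \<theta>) /\<^sub>R 2)
        + (\<mu> \<theta> + \<psi> \<theta> / 6 * N h \<theta>) *\<^sub>R ((1/2) *\<^sub>R E h \<theta>)"
        unfolding \<psi>_def[symmetric] dv
        by (intro always_eventually allI ballI) (unfold \<psi>_def, rule id)
    qed
  qed

  \<comment> \<open>Comparison with the curve in the tangent plane\<close>
  have Pg: "unif_O 5 (\<lambda>h \<theta>. pj h (g h \<theta>) - (h *\<^sub>R (\<mu> \<theta> *\<^sub>R a1 h \<theta>)
    + h^2 *\<^sub>R ((\<mu> \<theta>)^2 *\<^sub>R a2 h \<theta>) + h^3 *\<^sub>R ((\<mu> \<theta>)^3 *\<^sub>R a3 h \<theta>) + h^4 *\<^sub>R ((\<mu> \<theta>)^4 *\<^sub>R a4 h \<theta>)))"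
    using taypj[of "\<lambda>\<theta>. \<theta>"] by (simp add: g_def \<mu>_def)
  define F where "F = (\<lambda>h \<theta>. a3 h \<theta> + ((1/6) * (a1 h \<theta> \<bullet> a1 h \<theta>)) *\<^sub>R a1 h \<theta>)"
  define G where "G = (\<lambda>h \<theta>. a4 h \<theta> + (1/6) *\<^sub>R ((2 * (a1 h \<theta> \<bullet> a2 h \<theta>)) *\<^sub>R a1 h \<theta> + (a1 h \<theta> \<bullet> a1 h \<theta>) *\<^sub>R a2 h \<theta>))"
  have F: "unif_O 0 F" unfolding F_def by (intro unif_O_add bdd) auto
  have G: "unif_O 0 G" unfolding G_def by (intro unif_O_add bdd) auto
  have \<delta>: "unif_O 5 (\<lambda>h \<theta>. pj h (P h \<theta> - g h \<theta>) - h^3 *\<^sub>R (\<psi> \<theta> *\<^sub>R (F h \<theta> + h *\<^sub>R (\<mu> \<theta> *\<^sub>R G h \<theta>))))"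
  proof -
    have c: "continuous_on {0..4} (\<lambda>\<theta>. \<psi> \<theta> / 6)" "continuous_on {0..4} (\<lambda>\<theta>. 2 * (\<mu> \<theta>)^2)" "continuous_on {0..4} (\<lambda>\<theta>. 2 * \<mu> \<theta>)"
      by (intro continuous_intros; simp)+
    \<comment> \<open>All terms of order h^5 and above in the correction \<psi>/6 N V. The h and h^2
      terms cancel against the curve, and the h^3 and h^4 terms form F and \<mu> G.\<close>
    have "unif_O 5 (\<lambda>h \<theta>. h^5 *\<^sub>R ((\<psi> \<theta> / 6) *\<^sub>R ((2 * (\<mu> \<theta>)^2 * (a1 h \<theta> \<bullet> a2 h \<theta>)) *\<^sub>R a2 h \<theta>
        + (a1 h \<theta> \<bullet> a1 h \<theta> + h^1 * (2 * \<mu> \<theta> * (a1 h \<theta> \<bullet> a2 h \<theta>))) *\<^sub>R (a3 h \<theta> + h^1 *\<^sub>R (\<mu> \<theta> *\<^sub>R a4 h \<theta>)))))"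
      by (intro unif_O_pow_scaleR unif_O_add unif_O_bounded_scaleR unif_O_bounded_inner a_O
          unif_O_bounded_mult[OF unif_O_theta] unif_O_pow_mult unif_O_theta c cont) auto
    from unif_O_add[OF unif_O_diff[OF PP Pg] this] show ?thesis
    proof (rule unif_O_cong)
      have id: "(m + m * (1 - m^2) / 6 * (h^2 * \<kappa> + h^3 * (2 * (m * \<rho>)))) *\<^sub>R
            (h *\<^sub>R b1 + h^3 *\<^sub>R b3 + m *\<^sub>R (h^2 *\<^sub>R b2 + h^4 *\<^sub>R b4))
          - (h *\<^sub>R (m *\<^sub>R b1) + h^2 *\<^sub>R (m^2 *\<^sub>R b2) + h^3 *\<^sub>R (m^3 *\<^sub>R b3) + h^4 *\<^sub>R (m^4 *\<^sub>R b4))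
          = h^3 *\<^sub>R ((m * (1 - m^2)) *\<^sub>R ((b3 + ((1/6) * \<kappa>) *\<^sub>R b1)
             + h *\<^sub>R (m *\<^sub>R (b4 + (1/6) *\<^sub>R ((2 * \<rho>) *\<^sub>R b1 + \<kappa> *\<^sub>R b2)))))
          + h^5 *\<^sub>R ((m * (1 - m^2) / 6) *\<^sub>R ((2 * m^2 * \<rho>) *\<^sub>R b2
        + (\<kappa> + h^1 * (2 * m * \<rho>)) *\<^sub>R (b3 + h^1 *\<^sub>R (m *\<^sub>R b4))))"
        for m h \<kappa> \<rho> :: real and b1 b2 b3 b4 :: "real^3"
        by (simp add: vec_eq_iff field_simps eval_nat_numeral)
      have "(\<mu> \<theta> + \<psi> \<theta> / 6 * N h \<theta>) *\<^sub>R V h \<theta> - (h *\<^sub>R (\<mu> \<theta> *\<^sub>R a1 h \<theta>)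
    + h^2 *\<^sub>R ((\<mu> \<theta>)^2 *\<^sub>R a2 h \<theta>) + h^3 *\<^sub>R ((\<mu> \<theta>)^3 *\<^sub>R a3 h \<theta>) + h^4 *\<^sub>R ((\<mu> \<theta>)^4 *\<^sub>R a4 h \<theta>))
        = h^3 *\<^sub>R (\<psi> \<theta> *\<^sub>R (F h \<theta> + h *\<^sub>R (\<mu> \<theta> *\<^sub>R G h \<theta>)))
        + h^5 *\<^sub>R ((\<psi> \<theta> / 6) *\<^sub>R ((2 * (\<mu> \<theta>)^2 * (a1 h \<theta> \<bullet> a2 h \<theta>)) *\<^sub>R a2 h \<theta>
        + (a1 h \<theta> \<bullet> a1 h \<theta> + h^1 * (2 * \<mu> \<theta> * (a1 h \<theta> \<bullet> a2 h \<theta>))) *\<^sub>R (a3 h \<theta> + h^1 *\<^sub>R (\<mu> \<theta> *\<^sub>R a4 h \<theta>))))" for h \<theta>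
        unfolding \<psi>_def N_def V_def F_def G_def by (rule id)
      then show "\<forall>\<^sub>F h in at_right 0. \<forall>\<theta>\<in>{0..4}. pj h (P h \<theta> - g h \<theta>) - h^3 *\<^sub>R (\<psi> \<theta> *\<^sub>R (F h \<theta> + h *\<^sub>R (\<mu> \<theta> *\<^sub>R G h \<theta>)))
        = pj h (P h \<theta>) - (\<mu> \<theta> + \<psi> \<theta> / 6 * N h \<theta>) *\<^sub>R V h \<theta> - (pj h (g h \<theta>) - (h *\<^sub>R (\<mu> \<theta> *\<^sub>R a1 h \<theta>)
    + h^2 *\<^sub>R ((\<mu> \<theta>)^2 *\<^sub>R a2 h \<theta>) + h^3 *\<^sub>R ((\<mu> \<theta>)^3 *\<^sub>R a3 h \<theta>) + h^4 *\<^sub>R ((\<mu> \<theta>)^4 *\<^sub>R a4 h \<theta>)))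
        + h^5 *\<^sub>R ((\<psi> \<theta> / 6) *\<^sub>R ((2 * (\<mu> \<theta>)^2 * (a1 h \<theta> \<bullet> a2 h \<theta>)) *\<^sub>R a2 h \<theta>
        + (a1 h \<theta> \<bullet> a1 h \<theta> + h^1 * (2 * \<mu> \<theta> * (a1 h \<theta> \<bullet> a2 h \<theta>))) *\<^sub>R (a3 h \<theta> + h^1 *\<^sub>R (\<mu> \<theta> *\<^sub>R a4 h \<theta>))))"
        by (intro always_eventually allI ballI) (simp only: pj_simps algebra_simps)
    qed
  qed

  \<comment> \<open>Normal component and reassembly\<close>
  have z: "unif_O 0 (\<lambda>h \<theta>. \<mu> \<theta> *\<^sub>R a1 h \<theta>)" by (intro bdd cont)
  have w: "unif_O 0 (\<lambda>h \<theta>. \<psi> \<theta> *\<^sub>R F h \<theta>)" by (intro bdd cont F)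
  have uv: "unif_O 4 (\<lambda>h \<theta>. tangent_proj (k * h) (P h \<theta> - g h \<theta>) - h^3 *\<^sub>R (\<psi> \<theta> *\<^sub>R F h \<theta>))"
  proof -
    have "unif_O 4 (\<lambda>h \<theta>. (pj h (P h \<theta> - g h \<theta>) - h^3 *\<^sub>R (\<psi> \<theta> *\<^sub>R (F h \<theta> + h *\<^sub>R (\<mu> \<theta> *\<^sub>R G h \<theta>))))
       + h^4 *\<^sub>R (\<psi> \<theta> *\<^sub>R (\<mu> \<theta> *\<^sub>R G h \<theta>)))"
      by (intro unif_O_add unif_O_mono[OF \<delta>] unif_O_pow_scaleR bdd cont G) auto
    then show ?thesis
      by (rule unif_O_cong) (simp add: pj_def algebra_simps eval_nat_numeral)
  qed
  have pP: "unif_O 2 (\<lambda>h \<theta>. tangent_proj (k * h) (P h \<theta>) - h *\<^sub>R (\<mu> \<theta> *\<^sub>R a1 h \<theta>))"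
  proof -
    have "unif_O 2 (\<lambda>h \<theta>. (pj h (P h \<theta>) - (\<mu> \<theta> + \<psi> \<theta> / 6 * N h \<theta>) *\<^sub>R V h \<theta>)
       + (\<mu> \<theta> *\<^sub>R (h^2 *\<^sub>R r1 h \<theta>) + (\<psi> \<theta> / 6 * N h \<theta>) *\<^sub>R V h \<theta>))"
      by (intro unif_O_add unif_O_mono[OF PP] unif_O_bounded_scaleR[OF unif_O_theta] unif_O_pow_scaleR r1
          unif_O_scaleR[OF unif_O_bounded_mult[OF unif_O_theta N] V] cont continuous_intros) auto
    then show ?thesis
      by (rule unif_O_cong) (simp add: pj_def V_r1 algebra_simps)
  qed
  have pg: "unif_O 2 (\<lambda>h \<theta>. tangent_proj (k * h) (g h \<theta>) - h *\<^sub>R (\<mu> \<theta> *\<^sub>R a1 h \<theta>))"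
  proof -
    have "unif_O 2 (\<lambda>h \<theta>. (pj h (g h \<theta>) - (h *\<^sub>R (\<mu> \<theta> *\<^sub>R a1 h \<theta>)
    + h^2 *\<^sub>R ((\<mu> \<theta>)^2 *\<^sub>R a2 h \<theta>) + h^3 *\<^sub>R ((\<mu> \<theta>)^3 *\<^sub>R a3 h \<theta>) + h^4 *\<^sub>R ((\<mu> \<theta>)^4 *\<^sub>R a4 h \<theta>)))
     + (h^2 *\<^sub>R ((\<mu> \<theta>)^2 *\<^sub>R a2 h \<theta>) + h^3 *\<^sub>R ((\<mu> \<theta>)^3 *\<^sub>R a3 h \<theta>) + h^4 *\<^sub>R ((\<mu> \<theta>)^4 *\<^sub>R a4 h \<theta>)))"
      by (intro unif_O_add unif_O_mono[OF Pg] unif_O_pow_scaleR unif_O_bounded_scaleR[OF unif_O_theta] a_O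
          cont continuous_intros) auto
    then show ?thesis
      by (rule unif_O_cong) (simp add: pj_def)
  qed
  \<comment> \<open>P and the curve share the leading tangential displacement h \<mu> a1; its inner
    product with the leading tangential error h^3 \<psi> F is, up to sign, the normal error.\<close>
  have normal: "unif_O 5 (\<lambda>h \<theta>. Q h \<theta> \<bullet> (P h \<theta> - g h \<theta>) + h^4 * ((\<psi> \<theta> *\<^sub>R F h \<theta>) \<bullet> (\<mu> \<theta> *\<^sub>R a1 h \<theta>)))"
    using normal_component_error[OF k(1) uP ug PQ[unfolded Q_def] dg[unfolded Q_def] w uv z pP pg]
    by (simp add: Q_def)
  have "unif_O 5 (\<lambda>h \<theta>. (pj h (P h \<theta> - g h \<theta>) - h^3 *\<^sub>R (\<psi> \<theta> *\<^sub>R (F h \<theta> + h *\<^sub>R (\<mu> \<theta> *\<^sub>R G h \<theta>))))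
    + (Q h \<theta> \<bullet> (P h \<theta> - g h \<theta>) + h^4 * ((\<psi> \<theta> *\<^sub>R F h \<theta>) \<bullet> (\<mu> \<theta> *\<^sub>R a1 h \<theta>))) *\<^sub>R Q h \<theta>)"
    by (intro unif_O_add \<delta> unif_O_scaleR[OF normal eventually_unit_unif_O[OF uQ]]) simp
  then have "unif_O 5 (\<lambda>h \<theta>. P h \<theta> - g h \<theta>
      - h^3 *\<^sub>R (\<psi> \<theta> *\<^sub>R (F h \<theta> + h *\<^sub>R (\<mu> \<theta> *\<^sub>R (G h \<theta> - (F h \<theta> \<bullet> a1 h \<theta>) *\<^sub>R Q h \<theta>)))))"
  proof (rule unif_O_cong)
    have dec: "P h \<theta> - g h \<theta> = pj h (P h \<theta> - g h \<theta>) + (Q h \<theta> \<bullet> (P h \<theta> - g h \<theta>)) *\<^sub>R Q h \<theta>" for h \<theta>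
      by (simp add: pj_def tangent_proj_def Q_def)
    \<comment> \<open>The normal error carries the factor \<psi> \<mu>, the same as the quartic
      tangential term, so both merge into one coefficient.\<close>
    have id: "(x + n *\<^sub>R y) - h^3 *\<^sub>R (p *\<^sub>R (f + h *\<^sub>R (m *\<^sub>R (d - c *\<^sub>R y))))
       = (x - h^3 *\<^sub>R (p *\<^sub>R (f + h *\<^sub>R (m *\<^sub>R d)))) + (n + h^4 * (p * (m * c))) *\<^sub>R y"
      for x y f d :: "real^3" and h n p m c :: real
      by (simp add: vec_eq_iff power3_eq_cube power4_eq_xxxx algebra_simps)
    show "\<forall>\<^sub>F h in at_right 0. \<forall>\<theta>\<in>{0..4}. P h \<theta> - g h \<theta>
      - h^3 *\<^sub>R (\<psi> \<theta> *\<^sub>R (F h \<theta> + h *\<^sub>R (\<mu> \<theta> *\<^sub>R (G h \<theta> - (F h \<theta> \<bullet> a1 h \<theta>) *\<^sub>R Q h \<theta>))))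
      = (pj h (P h \<theta> - g h \<theta>) - h^3 *\<^sub>R (\<psi> \<theta> *\<^sub>R (F h \<theta> + h *\<^sub>R (\<mu> \<theta> *\<^sub>R G h \<theta>))))
    + (Q h \<theta> \<bullet> (P h \<theta> - g h \<theta>) + h^4 * ((\<psi> \<theta> *\<^sub>R F h \<theta>) \<bullet> (\<mu> \<theta> *\<^sub>R a1 h \<theta>))) *\<^sub>R Q h \<theta>"
      unfolding inner_scaleR_left inner_scaleR_right
      by (intro always_eventually allI ballI, subst dec, subst mult.left_commute[of "\<mu> _"], rule id)
  qed
  moreover have "F h \<theta> = cubic_error (k * h)" "G h \<theta> - (F h \<theta> \<bullet> a1 h \<theta>) *\<^sub>R Q h \<theta> = quartic_error (k * h)" for h \<theta>
    by (simp_all add: F_def G_def cubic_error_def quartic_error_def a1_def a2_def a3_def a4_def Q_def)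
  ultimately have "unif_O 5 (\<lambda>h \<theta>. P h \<theta> - g h \<theta>
      - h^3 *\<^sub>R (\<psi> \<theta> *\<^sub>R (cubic_error (k * h) + h *\<^sub>R (\<mu> \<theta> *\<^sub>R quartic_error (k * h)))))"
    by simp
  then show "unif_O 5 (\<lambda>h \<theta>. sider2 (\<lambda>j. \<gamma> (real j * h)) i \<theta> - \<gamma> (\<theta> * h)
    - h^3 *\<^sub>R (((\<theta> - k) * (1 - (\<theta> - k)^2)) *\<^sub>R (cubic_error (k * h) + h *\<^sub>R ((\<theta> - k) *\<^sub>R quartic_error (k * h)))))"
    by (rule unif_O_cong) (use sider in \<open>auto elim!: eventually_mono simp: g_def \<psi>_def \<mu>_def\<close>)
qed

section \<open>From SIDER2 to SIDER4\<close>

text \<open>The coefficients at the middle node are expanded at 0, with one triple of vectors for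
  all stencils. Moving the base point changes the cubic coefficient by a term linear in i + 1, which
  joins the h^4 terms; for the quartic coefficient the change is already of order h^5.\<close>

lemma sider2_expansion:
  obtains a0 a1 b0 where
    "\<And>i. i \<le> 2 \<Longrightarrow> unif_O 5 (\<lambda>h \<theta>. sider2 (\<lambda>j. \<gamma> (real j * h)) i \<theta> - \<gamma> (\<theta> * h)
      - ((\<theta> - (real i + 1)) * (1 - (\<theta> - (real i + 1))^2)) *\<^sub>R
        (h^3 *\<^sub>R a0 + h^4 *\<^sub>R ((real i + 1) *\<^sub>R a1 + (\<theta> - (real i + 1)) *\<^sub>R b0)))"
proof -
  obtain a0 a1 where A: "\<And>k. 0 \<le> k \<Longrightarrow> unif_O 2 (\<lambda>h \<theta>. cubic_error (k * h) - a0 - (k * h) *\<^sub>R a1)"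
    using affine_upto_unif_O[OF affine_upto_cubic_error[of 2] T_pos] by auto
  obtain b0 b1 where B: "\<And>k. 0 \<le> k \<Longrightarrow> unif_O 1 (\<lambda>h \<theta>. quartic_error (k * h) - b0 - (k * h) *\<^sub>R b1)"
    using affine_upto_unif_O[OF affine_upto_quartic_error T_pos] by auto
  have "unif_O 5 (\<lambda>h \<theta>. sider2 (\<lambda>j. \<gamma> (real j * h)) i \<theta> - \<gamma> (\<theta> * h)
      - ((\<theta> - (real i + 1)) * (1 - (\<theta> - (real i + 1))^2)) *\<^sub>R
        (h^3 *\<^sub>R a0 + h^4 *\<^sub>R ((real i + 1) *\<^sub>R a1 + (\<theta> - (real i + 1)) *\<^sub>R b0)))" if i: "i \<le> 2" for i
  proof -
    define k where "k = real i + 1"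
    have k: "0 \<le> k" by (simp add: k_def)
    define \<psi> where "\<psi> = (\<lambda>\<theta>. (\<theta> - k) * (1 - (\<theta> - k)^2))"
    have cont: "continuous_on {0..4} \<psi>" "continuous_on {0..4} (\<lambda>\<theta>. \<theta> - k)"
      unfolding \<psi>_def by (intro continuous_intros)+
    have "unif_O 1 (\<lambda>h \<theta>. (quartic_error (k * h) - b0 - (k * h) *\<^sub>R b1) + h^1 *\<^sub>R (k *\<^sub>R b1))"
      by (intro unif_O_add B[OF k] unif_O_pow_scaleR unif_O_const) auto
    then have B': "unif_O 1 (\<lambda>h \<theta>. quartic_error (k * h) - b0)"
      by (rule unif_O_cong) (simp add: mult.commute)
    have "unif_O 5 (\<lambda>h \<theta>. (sider2 (\<lambda>j. \<gamma> (real j * h)) i \<theta> - \<gamma> (\<theta> * h)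
      - h^3 *\<^sub>R (\<psi> \<theta> *\<^sub>R (cubic_error (k * h) + h *\<^sub>R ((\<theta> - k) *\<^sub>R quartic_error (k * h)))))
      + (\<psi> \<theta> *\<^sub>R (h^3 *\<^sub>R (cubic_error (k * h) - a0 - (k * h) *\<^sub>R a1))
         + \<psi> \<theta> *\<^sub>R ((\<theta> - k) *\<^sub>R (h^4 *\<^sub>R (quartic_error (k * h) - b0)))))"
      using sider2_error[OF i]
      by (intro unif_O_add unif_O_bounded_scaleR[OF unif_O_theta] cont
          unif_O_scaleR[OF unif_O_power A[OF k]] unif_O_scaleR[OF unif_O_power B'])
        (auto simp: \<psi>_def k_def)
    then show ?thesis
      unfolding k_def[symmetric] \<psi>_def
      by (rule unif_O_cong) (simp add: vec_eq_iff power3_eq_cube power4_eq_xxxx algebra_simps)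
  qed
  then show thesis by (rule that)
qed

lemma
  shows eventually_unit_sider4: "eventually_unit (\<lambda>h \<theta>. sider (\<lambda>j. \<gamma> (real j * h)) 4 0 \<theta>)"
    and unif_O_sider4: "unif_O 5 (\<lambda>h \<theta>. sider (\<lambda>j. \<gamma> (real j * h)) 4 0 \<theta> - \<gamma> (\<theta> * h))"
proof -
  define g where "g = (\<lambda>h \<theta>. \<gamma> (\<theta> * h))"
  define S where "S i = (\<lambda>h \<theta>. sider2 (\<lambda>j. \<gamma> (real j * h)) i \<theta>)" for i
  \<comment> \<open>The SIDER3 level. For i \<le> 1 its parameter lies in [-1/3, 4/3], within the
    range of the slerp estimates.\<close>
  define P where "P i = (\<lambda>h \<theta>. slerp (S i h \<theta>) (S (i + 1) h \<theta>) ((\<theta> - real i) / 3))" for i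
  have sider4: "sider (\<lambda>j. \<gamma> (real j * h)) 4 0 \<theta> = slerp (P 0 h \<theta>) (P 1 h \<theta>) (\<theta> / 4)" for h \<theta>
    by (simp add: P_def S_def sider.simps numeral_2_eq_2)
  obtain a0 a1 b0 where ex: "\<And>i. i \<le> 2 \<Longrightarrow> unif_O 5 (\<lambda>h \<theta>. S i h \<theta> - g h \<theta>
      - ((\<theta> - (real i + 1)) * (1 - (\<theta> - (real i + 1))^2)) *\<^sub>R
        (h^3 *\<^sub>R a0 + h^4 *\<^sub>R ((real i + 1) *\<^sub>R a1 + (\<theta> - (real i + 1)) *\<^sub>R b0)))"
    using sider2_expansion unfolding S_def g_def by blast
  define X where "X i = (\<lambda>h \<theta>. ((\<theta> - (real i + 1)) * (1 - (\<theta> - (real i + 1))^2)) *\<^sub>R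
        (h^3 *\<^sub>R a0 + h^4 *\<^sub>R ((real i + 1) *\<^sub>R a1 + (\<theta> - (real i + 1)) *\<^sub>R b0)))" for i
  have SX: "unif_O 5 (\<lambda>h \<theta>. S i h \<theta> - g h \<theta> - X i h \<theta>)" if "i \<le> 2" for i
    using ex[OF that] by (simp add: X_def)
  have uS: "eventually_unit (S i)" if "i \<le> 2" for i
    using eventually_unit_sider2[OF that] by (simp add: S_def)
  have Sg: "unif_O 3 (\<lambda>h \<theta>. S i h \<theta> - g h \<theta>)" if "i \<le> 2" for i
  proof -
    have X: "unif_O 3 (X i)"
      unfolding X_def
      by (intro unif_O_bounded_scaleR[OF unif_O_theta] unif_O_add unif_O_pow_scaleR unif_O_const
          unif_O_bounded_scaleR unif_O_theta continuous_intros) auto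
    have "unif_O 3 (\<lambda>h \<theta>. (S i h \<theta> - g h \<theta> - X i h \<theta>) + X i h \<theta>)"
      by (intro unif_O_add unif_O_mono[OF SX[OF that]] X) simp
    then show ?thesis by simp
  qed
  have SS: "unif_O 3 (\<lambda>h \<theta>. S (i + 1) h \<theta> - S i h \<theta>)" if "i \<le> 1" for i
    using unif_O_diff[OF Sg[of "i + 1"] Sg[of i]] that by simp
  have uP: "eventually_unit (P i)" if "i \<le> 1" for i
    unfolding P_def by (rule eventually_unit_slerp[OF uS uS SS]) (use that in auto)
  have Paff: "unif_O 6 (\<lambda>h \<theta>. P i h \<theta> - ((1 - (\<theta> - real i) / 3) *\<^sub>R S i h \<theta> + ((\<theta> - real i) / 3) *\<^sub>R S (i + 1) h \<theta>))"
    if "i \<le> 1" for i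
    unfolding P_def by (rule unif_O_slerp_affine[OF uS uS SS]) (use that in auto)
  have Pg: "unif_O 3 (\<lambda>h \<theta>. P i h \<theta> - g h \<theta>)" if "i \<le> 1" for i
  proof -
    have "unif_O 3 (\<lambda>h \<theta>. (P i h \<theta> - ((1 - (\<theta> - real i) / 3) *\<^sub>R S i h \<theta> + ((\<theta> - real i) / 3) *\<^sub>R S (i + 1) h \<theta>))
       + ((1 - (\<theta> - real i) / 3) *\<^sub>R (S i h \<theta> - g h \<theta>) + ((\<theta> - real i) / 3) *\<^sub>R (S (i + 1) h \<theta> - g h \<theta>)))"
      using that
      by (intro unif_O_add unif_O_mono[OF Paff] unif_O_bounded_scaleR[OF unif_O_theta] Sg continuous_intros) auto
    then show ?thesis by (rule unif_O_cong) (simp add: algebra_simps)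
  qed
  have PP: "unif_O 3 (\<lambda>h \<theta>. P 1 h \<theta> - P 0 h \<theta>)"
    using unif_O_diff[OF Pg[of 1] Pg[of 0]] by simp
  show "eventually_unit (\<lambda>h \<theta>. sider (\<lambda>j. \<gamma> (real j * h)) 4 0 \<theta>)"
    unfolding sider4 by (rule eventually_unit_slerp[OF uP uP PP]) auto
  have 4: "unif_O 5 (\<lambda>h \<theta>. slerp (P 0 h \<theta>) (P 1 h \<theta>) (\<theta> / 4) - ((1 - \<theta> / 4) *\<^sub>R P 0 h \<theta> + (\<theta> / 4) *\<^sub>R P 1 h \<theta>))"
    by (rule unif_O_slerp_affine[OF uP uP PP]) auto
  have 30: "unif_O 5 (\<lambda>h \<theta>. P 0 h \<theta> - ((1 - \<theta> / 3) *\<^sub>R S 0 h \<theta> + (\<theta> / 3) *\<^sub>R S 1 h \<theta>))"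
    using unif_O_mono[OF Paff[of 0], of 5] by simp
  have 31: "unif_O 5 (\<lambda>h \<theta>. P 1 h \<theta> - ((1 - (\<theta> - 1) / 3) *\<^sub>R S 1 h \<theta> + ((\<theta> - 1) / 3) *\<^sub>R S 2 h \<theta>))"
    using unif_O_mono[OF Paff[of 1], of 5] by (simp add: numeral_2_eq_2)
  \<comment> \<open>The two affine steps multiplied out, as in Neville's scheme: w0 = (4 -
    \<theta>)(3 - \<theta>)/12, w1 = \<theta>(4 - \<theta>)/6, w2 = \<theta>(\<theta> -
    1)/12.\<close>
  define w0 where "w0 = (\<lambda>\<theta>::real. (1 - \<theta> / 4) * (1 - \<theta> / 3))"
  define w1 where "w1 = (\<lambda>\<theta>::real. (1 - \<theta> / 4) * (\<theta> / 3) + \<theta> / 4 * (1 - (\<theta> - 1) / 3))"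
  define w2 where "w2 = (\<lambda>\<theta>::real. \<theta> / 4 * ((\<theta> - 1) / 3))"
  have w: "continuous_on {0..4} w0" "continuous_on {0..4} w1" "continuous_on {0..4} w2"
    unfolding w0_def w1_def w2_def by (intro continuous_intros; simp)+
  \<comment> \<open>Each weight supplies the two nodes missing from its cubic. The three products
    are \<theta>(\<theta> - 1)(\<theta> - 2)(\<theta> - 3)(\<theta> - 4)/12 times -1, 2, -1, so the
    sum is a second difference in i of terms affine in i.\<close>
  have X0: "w0 \<theta> *\<^sub>R X 0 h \<theta> + w1 \<theta> *\<^sub>R X 1 h \<theta> + w2 \<theta> *\<^sub>R X 2 h \<theta> = 0" for h \<theta>
    by (simp add: X_def w0_def w1_def w2_def vec_eq_iff field_simps eval_nat_numeral)
  have "unif_O 5 (\<lambda>h \<theta>. (slerp (P 0 h \<theta>) (P 1 h \<theta>) (\<theta> / 4) - ((1 - \<theta> / 4) *\<^sub>R P 0 h \<theta> + (\<theta> / 4) *\<^sub>R P 1 h \<theta>))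
      + (1 - \<theta> / 4) *\<^sub>R (P 0 h \<theta> - ((1 - \<theta> / 3) *\<^sub>R S 0 h \<theta> + (\<theta> / 3) *\<^sub>R S 1 h \<theta>))
      + (\<theta> / 4) *\<^sub>R (P 1 h \<theta> - ((1 - (\<theta> - 1) / 3) *\<^sub>R S 1 h \<theta> + ((\<theta> - 1) / 3) *\<^sub>R S 2 h \<theta>))
      + (w0 \<theta> *\<^sub>R (S 0 h \<theta> - g h \<theta> - X 0 h \<theta>) + w1 \<theta> *\<^sub>R (S 1 h \<theta> - g h \<theta> - X 1 h \<theta>)
         + w2 \<theta> *\<^sub>R (S 2 h \<theta> - g h \<theta> - X 2 h \<theta>)))"
    by (intro unif_O_add unif_O_bounded_scaleR[OF unif_O_theta] 4 30 31 SX w continuous_intros) auto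
  then show "unif_O 5 (\<lambda>h \<theta>. sider (\<lambda>j. \<gamma> (real j * h)) 4 0 \<theta> - \<gamma> (\<theta> * h))"
  proof (rule unif_O_cong)
    have id: "z - y = (z - ((1 - t / 4) *\<^sub>R p + (t / 4) *\<^sub>R p'))
      + (1 - t / 4) *\<^sub>R (p - ((1 - t / 3) *\<^sub>R s0 + (t / 3) *\<^sub>R s1))
      + (t / 4) *\<^sub>R (p' - ((1 - (t - 1) / 3) *\<^sub>R s1 + ((t - 1) / 3) *\<^sub>R s2))
      + (w0 t *\<^sub>R (s0 - y - x0) + w1 t *\<^sub>R (s1 - y - x1) + w2 t *\<^sub>R (s2 - y - x2))"
      if "w0 t *\<^sub>R x0 + w1 t *\<^sub>R x1 + w2 t *\<^sub>R x2 = 0"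
      for z y p p' s0 s1 s2 x0 x1 x2 :: "real^3" and t :: real
    proof -
      have e: "w0 t *\<^sub>R (s0 - y - x0) + w1 t *\<^sub>R (s1 - y - x1) + w2 t *\<^sub>R (s2 - y - x2)
        = w0 t *\<^sub>R (s0 - y) + w1 t *\<^sub>R (s1 - y) + w2 t *\<^sub>R (s2 - y)
          - (w0 t *\<^sub>R x0 + w1 t *\<^sub>R x1 + w2 t *\<^sub>R x2)"
        by (simp add: algebra_simps)
      show ?thesis
        unfolding e that by (simp add: w0_def w1_def w2_def vec_eq_iff field_simps)
    qed
    show "\<forall>\<^sub>F h in at_right 0. \<forall>\<theta>\<in>{0..4}. sider (\<lambda>j. \<gamma> (real j * h)) 4 0 \<theta> - \<gamma> (\<theta> * h) =
      (slerp (P 0 h \<theta>) (P 1 h \<theta>) (\<theta> / 4) - ((1 - \<theta> / 4) *\<^sub>R P 0 h \<theta> + (\<theta> / 4) *\<^sub>R P 1 h \<theta>))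
      + (1 - \<theta> / 4) *\<^sub>R (P 0 h \<theta> - ((1 - \<theta> / 3) *\<^sub>R S 0 h \<theta> + (\<theta> / 3) *\<^sub>R S 1 h \<theta>))
      + (\<theta> / 4) *\<^sub>R (P 1 h \<theta> - ((1 - (\<theta> - 1) / 3) *\<^sub>R S 1 h \<theta> + ((\<theta> - 1) / 3) *\<^sub>R S 2 h \<theta>))
      + (w0 \<theta> *\<^sub>R (S 0 h \<theta> - g h \<theta> - X 0 h \<theta>) + w1 \<theta> *\<^sub>R (S 1 h \<theta> - g h \<theta> - X 1 h \<theta>)
         + w2 \<theta> *\<^sub>R (S 2 h \<theta> - g h \<theta> - X 2 h \<theta>))"
      unfolding sider4 g_def[symmetric]
      by (intro always_eventually allI ballI) (unfold g_def, rule id[OF X0])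
  qed
qed

end

theorem theorem2:
  fixes \<gamma> :: "real \<Rightarrow> real^3" and T :: real
  assumes "0 < T"
    and "C_k_on 5 \<gamma> {0..T}"
    and "\<gamma> ` {0..T} \<subseteq> sphere2"
    and "\<exists>K. \<forall>\<^sub>F h in at_right 0. \<exists>c\<in>sphere2. \<exists>r\<le>K * h.
           geodesically_convex (geodesic_ball c r) \<and>
           sider4_points (\<lambda>j. \<gamma> (real j * h)) \<subseteq> geodesic_ball c r"
  shows "\<exists>C. \<forall>\<^sub>F h in at_right 0. \<forall>\<theta>\<in>{0..4}.
           sphere_dist (\<gamma> (\<theta> * h)) (sider (\<lambda>j. \<gamma> (real j * h)) 4 0 \<theta>) \<le> C * h ^ 5"
proof -
  obtain D where "\<forall>t\<in>{0..T}. D 0 t = \<gamma> t"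
    "\<forall>j<5. \<forall>t\<in>{0..T}. (D j has_vector_derivative D (Suc j) t) (at t within {0..T})"
    "continuous_on {0..T} (D 5)"
    using assms(2) unfolding C_k_on_def by blast
  moreover have "norm (\<gamma> t) = 1" if "t \<in> {0..T}" for t
    using assms(3) that by (simp add: image_subset_iff)
  ultimately interpret sphere_curve \<gamma> T D
    using assms(1) by unfold_locales auto
  obtain C where C: "\<forall>\<^sub>F h in at_right 0. \<forall>\<theta>\<in>{0..4}.
      norm (sider (\<lambda>j. \<gamma> (real j * h)) 4 0 \<theta> - \<gamma> (\<theta> * h)) \<le> C * h ^ 5"
    using unif_O_sider4 by (auto simp: unif_O_def)
  have "eventually_unit (\<lambda>h \<theta>. \<gamma> (\<theta> * h))"
    by (rule eventually_unit_curve[of "\<lambda>\<theta>. \<theta>"]) auto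
  \<comment> \<open>The constant doubles in passing from chords to arcs.\<close>
  from C this eventually_unit_sider4
  have "\<forall>\<^sub>F h in at_right 0. \<forall>\<theta>\<in>{0..4}.
      sphere_dist (\<gamma> (\<theta> * h)) (sider (\<lambda>j. \<gamma> (real j * h)) 4 0 \<theta>) \<le> (2 * C) * h ^ 5"
    unfolding eventually_unit_def
  proof eventually_elim
    case (elim h)
    show ?case
    proof
      fix \<theta> :: real assume "\<theta> \<in> {0..4}"
      then show "sphere_dist (\<gamma> (\<theta> * h)) (sider (\<lambda>j. \<gamma> (real j * h)) 4 0 \<theta>) \<le> (2 * C) * h ^ 5"
        using elim sphere_dist_le_chord[of "\<gamma> (\<theta> * h)" "sider (\<lambda>j. \<gamma> (real j * h)) 4 0 \<theta>"] by force
    qed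
  qed
  then show ?thesis by blast
qed

end
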